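(* For every $m\in\mathbb{N}_0$, $$\sum_{n=0}^\infty\frac{1}{4^n}\binom{2n}{n}\frac{t^\star_{n+1}(1_m)}{2n+1}=\frac{4}{\pi}\sum_{k=0}^m\sum_{n=0}^\infty\frac{t_n(1_k)t^\star_{n+1}(1_{m-k})}{(2n+1)^2}=\frac{4}{\pi}\sum_{d=1}^{m+1}\sum_{\substack{\mathbf{s}=(s_1,\dots,s_d)\in\mathbb{N}^d\\|\mathbf{s}|=m+2,\ s_1\ge2}}2^{d-1}t(\mathbf{s}),$$ which lies in $\frac{1}{\pi}\mathrm{MtV}_{m+2}\subset\frac{1}{\pi}\mathrm{CMZV}^2_{m+2}$.
   Context: For $n\in\mathbb{N}_0$ and a composition $\mathbf{k}$: $t_n(\mathbf{k})=\sum_{n\ge n_1>\cdots>n_r>0}\prod_j(2n_j-1)^{-k_j}$, $t^\star_n(\mathbf{k})$ the same with $\ge$, both equal $1$ on the empty composition; $1_d$ is the string of $d$ ones. For $\mathbf{s}$ with $s_1\ge2$, the multiple $t$-value is $t(\mathbf{s})=\sum_{n_1>\cdots>n_d>0}\prod_j(2n_j-1)^{-s_j}$; $\mathrm{MtV}_w$ is the $\mathbb{Q}$-span of multiple $t$-values of weight $w$. $\mathrm{CMZV}^2_w$ is the $\mathbb{Q}$-span of alternating multiple zeta values $\sum_{n_1>\cdots>n_r>0}\prod_j\varepsilon_j^{n_j}n_j^{-k_j}$ ($\varepsilon_j=\pm1$, $(k_1,\varepsilon_1)\ne(1,1)$) of weight $w$. *)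

theory Defs
  imports "HOL-Analysis.Analysis"
begin

text \<open>
  Compositions, and the index tuples \<open>(n\<^sub>1, \<dots>, n\<^sub>r)\<close> of the nested sums, are lists with the
  largest index first.  Since list positions start at 0, \<open>ks ! j\<close> is \<open>k\<^sub>j\<^sub>+\<^sub>1\<close> and \<open>hd ks\<close> is \<open>k\<^sub>1\<close>.
\<close>

definition compositions :: "nat \<Rightarrow> nat list set" where
  "compositions w = {ks. 0 \<notin> set ks \<and> sum_list ks = w}"

definition strict_indices :: "nat \<Rightarrow> nat \<Rightarrow> nat list set" where
  "strict_indices r N = {ns. length ns = r \<and> sorted_wrt (>) ns \<and> set ns \<subseteq> {1..N}}"

definition weak_indices :: "nat \<Rightarrow> nat \<Rightarrow> nat list set" where
  "weak_indices r N = {ns. length ns = r \<and> sorted_wrt (\<ge>) ns \<and> set ns \<subseteq> {1..N}}"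

definition t_term :: "nat list \<Rightarrow> nat list \<Rightarrow> real" where
  "t_term ks ns = (\<Prod>j<length ks. 1 / (2 * real (ns ! j) - 1) ^ (ks ! j))"

definition t_sum :: "nat \<Rightarrow> nat list \<Rightarrow> real" where
  "t_sum n ks = (\<Sum>ns\<in>strict_indices (length ks) n. t_term ks ns)"

definition t_star_sum :: "nat \<Rightarrow> nat list \<Rightarrow> real" where
  "t_star_sum n ks = (\<Sum>ns\<in>weak_indices (length ks) n. t_term ks ns)"

abbreviation ones :: "nat \<Rightarrow> nat list" where
  "ones d \<equiv> replicate d 1"

definition mtv :: "nat list \<Rightarrow> real" where
  "mtv s = (\<Sum>\<^sub>\<infinity>ns\<in>{ns. length ns = length s \<and> sorted_wrt (>) ns \<and> 0 \<notin> set ns}. t_term s ns)"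

definition alt_mzv_sum :: "nat \<Rightarrow> nat list \<Rightarrow> real list \<Rightarrow> real" where
  "alt_mzv_sum N ks es =
     (\<Sum>ns\<in>strict_indices (length ks) N.
        \<Prod>j<length ks. (es ! j) ^ (ns ! j) / real (ns ! j) ^ (ks ! j))"

text \<open>
  If \<open>k\<^sub>1 = 1\<close> and \<open>\<epsilon>\<^sub>1 = -1\<close>, the series converges only conditionally.  It is therefore summed,
  as usual, by letting the bound on the largest index tend to infinity.
\<close>

definition alt_mzv :: "nat list \<Rightarrow> real list \<Rightarrow> real" where
  "alt_mzv ks es = lim (\<lambda>N. alt_mzv_sum N ks es)"

lemma vector_space_rat_real: "vector_space (\<lambda>(q::rat) (x::real). of_rat q * x)"
  by unfold_locales (simp_all add: algebra_simps of_rat_add of_rat_mult)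

definition rat_span :: "real set \<Rightarrow> real set" where
  "rat_span = module.span (\<lambda>(q::rat) (x::real). of_rat q * x)"

definition MtV :: "nat \<Rightarrow> real set" where
  "MtV w = rat_span {mtv s | s. s \<in> compositions w \<and> (s = [] \<or> hd s \<ge> 2)}"

definition CMZV2 :: "nat \<Rightarrow> real set" where
  "CMZV2 w = rat_span {alt_mzv ks es | ks es.
     ks \<in> compositions w \<and> length es = length ks \<and> set es \<subseteq> {1, -1} \<and>
     (ks = [] \<or> (hd ks, hd es) \<noteq> (1, 1))}"

end

theory Submission
  imports
    Defs
    "HOL-Real_Asymp.Real_Asymp"
    "HOL-Complex_Analysis.Cauchy_Integral_Formula"
begin

text \<open>
  For the first equality, let \<open>A y\<close> and \<open>G y\<close> be the generating functions at \<open>- y\<close>, with respect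
  to \<open>m\<close>, of the two series (without the factor \<open>4 / pi\<close>).  The products of the
  generating functions of \<open>t\<^sub>n(1\<^sub>k)\<close> and \<open>t\<^sup>\<star>\<^sub>n(1\<^sub>k)\<close> make both of them hypergeometric series in
  \<open>n\<close>, and creative telescoping in the style of Zeilberger shows that both satisfy
  \<open>(2 + y)\<^sup>2 * F (y + 2) = (1 + y)\<^sup>2 * F y\<close>.  Since \<open>y * A y\<close> tends to 1 and \<open>y * G y\<close> tends to
  \<open>pi / 4\<close> as \<open>y\<close> grows, this recursion forces \<open>A y = 4 / pi * G y\<close> for small positive \<open>y\<close>, and
  coefficients can be compared.

  The second equality compares coefficients in the identity
  \<open>1 + 2 * (\<Sum>k>0. (c * x) ^ k) = (1 + c * x) / (1 - c * x)\<close>, taken over \<open>c = 1, 1/3, 1/5, \<dots>\<close>.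
  Finally, multiple \<open>t\<close>-values are alternating multiple zeta values because the indicator function
  of the odd numbers is \<open>n \<mapsto> (1 - (-1) ^ n) / 2\<close>.
\<close>

unbundle no vec_syntax and fps_syntax

section \<open>Nested sums\<close>

text \<open>A common generalisation of \<open>t_sum\<close> and \<open>alt_mzv_sum\<close> with an
  arbitrary weight at each position, so that recursion and growth bound are proved only
  once.\<close>

definition nested_sum :: "nat \<Rightarrow> (nat \<Rightarrow> real) list \<Rightarrow> real" where
  "nested_sum N ws = (\<Sum>ns\<in>strict_indices (length ws) N. \<Prod>j<length ws. (ws ! j) (ns ! j))"

lemma strict_indices_0 [simp]: "strict_indices 0 N = {[]}"
  by (auto simp: strict_indices_def)

lemma strict_indices_Suc_0 [simp]: "strict_indices (Suc r) 0 = {}"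
  by (auto simp: strict_indices_def)

lemma weak_indices_0 [simp]: "weak_indices 0 N = {[]}"
  by (auto simp: weak_indices_def)

lemma weak_indices_Suc_0 [simp]: "weak_indices (Suc r) 0 = {}"
  by (auto simp: weak_indices_def)

lemma finite_strict_indices [simp]: "finite (strict_indices r N)"
  by (rule finite_subset[OF _ finite_lists_length_eq[of "{1..N}" r]])
     (auto simp: strict_indices_def)

lemma finite_weak_indices [simp]: "finite (weak_indices r N)"
  by (rule finite_subset[OF _ finite_lists_length_eq[of "{1..N}" r]])
     (auto simp: weak_indices_def)

lemma strict_indices_mono: "M \<le> N \<Longrightarrow> strict_indices r M \<subseteq> strict_indices r N"
  by (fastforce simp: strict_indices_def)

text \<open>The head is the largest entry, so a tuple either ignores \<open>Suc N\<close> or starts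
  with it; in the latter case the tail is bounded by \<open>N\<close>.\<close>

lemma strict_indices_Suc_Suc:
  "strict_indices (Suc r) (Suc N) = strict_indices (Suc r) N \<union> (#) (Suc N) ` strict_indices r N"
proof (intro equalityI subsetI)
  fix ns assume a: "ns \<in> strict_indices (Suc r) (Suc N)"
  then obtain k ks where ns: "ns = k # ks"
    by (cases ns) (auto simp: strict_indices_def)
  show "ns \<in> strict_indices (Suc r) N \<union> (#) (Suc N) ` strict_indices r N"
  proof (cases "k = Suc N")
    case True
    then have "ks \<in> strict_indices r N"
      using a ns by (fastforce simp: strict_indices_def)
    then show ?thesis using True ns by auto
  next
    case False
    then have "ns \<in> strict_indices (Suc r) N"
      using a ns by (fastforce simp: strict_indices_def)
    then show ?thesis by auto
  qed
next
  fix ns assume "ns \<in> strict_indices (Suc r) N \<union> (#) (Suc N) ` strict_indices r N"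
  then show "ns \<in> strict_indices (Suc r) (Suc N)"
    by (fastforce simp: strict_indices_def)
qed

text \<open>As in the strict case, except that the tail may repeat \<open>Suc N\<close> and thus
  keeps this bound.\<close>

lemma weak_indices_Suc_Suc:
  "weak_indices (Suc r) (Suc N) = weak_indices (Suc r) N \<union> (#) (Suc N) ` weak_indices r (Suc N)"
proof (intro equalityI subsetI)
  fix ns assume a: "ns \<in> weak_indices (Suc r) (Suc N)"
  then obtain k ks where ns: "ns = k # ks"
    by (cases ns) (auto simp: weak_indices_def)
  show "ns \<in> weak_indices (Suc r) N \<union> (#) (Suc N) ` weak_indices r (Suc N)"
  proof (cases "k = Suc N")
    case True
    then have "ks \<in> weak_indices r (Suc N)"
      using a ns by (fastforce simp: weak_indices_def)
    then show ?thesis using True ns by auto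
  next
    case False
    then have "ns \<in> weak_indices (Suc r) N"
      using a ns by (fastforce simp: weak_indices_def)
    then show ?thesis by auto
  qed
next
  fix ns assume "ns \<in> weak_indices (Suc r) N \<union> (#) (Suc N) ` weak_indices r (Suc N)"
  then show "ns \<in> weak_indices (Suc r) (Suc N)"
    by (fastforce simp: weak_indices_def)
qed

lemma nested_sum_Nil [simp]: "nested_sum N [] = 1"
  by (simp add: nested_sum_def)

lemma nested_sum_0_Cons [simp]: "nested_sum 0 (w # ws) = 0"
  by (simp add: nested_sum_def)

lemma nested_sum_Suc_Cons:
  "nested_sum (Suc N) (w # ws) = nested_sum N (w # ws) + w (Suc N) * nested_sum N ws"
proof -
  have "strict_indices (Suc r) N \<inter> (#) (Suc N) ` strict_indices r N = {}" for r
    by (auto simp: strict_indices_def)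
  then show ?thesis
    by (simp add: nested_sum_def strict_indices_Suc_Suc sum.union_disjoint sum.reindex
        prod.lessThan_Suc_shift sum_distrib_left del: prod.lessThan_Suc)
qed

lemma t_sum_conv_nested_sum:
  "t_sum N ks = nested_sum N (map (\<lambda>k n. 1 / (2 * real n - 1) ^ k) ks)"
  by (simp add: t_sum_def nested_sum_def t_term_def)

lemma alt_mzv_sum_conv_nested_sum:
  assumes "length es = length ks"
  shows "alt_mzv_sum N ks es = nested_sum N (map2 (\<lambda>k e n. e ^ n / real n ^ k) ks es)"
  using assms by (simp add: alt_mzv_sum_def nested_sum_def)

lemma t_sum_Nil [simp]: "t_sum N [] = 1"
  by (simp add: t_sum_conv_nested_sum)

lemma t_sum_0_Cons [simp]: "t_sum 0 (k # ks) = 0"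
  by (simp add: t_sum_conv_nested_sum)

lemma t_sum_Suc_Cons:
  "t_sum (Suc N) (k # ks) = t_sum N (k # ks) + t_sum N ks / (2 * real N + 1) ^ k"
  by (simp add: t_sum_conv_nested_sum nested_sum_Suc_Cons add.commute)

lemma t_star_sum_Nil [simp]: "t_star_sum N [] = 1"
  by (simp add: t_star_sum_def t_term_def)

lemma t_star_sum_0_Cons [simp]: "t_star_sum 0 (k # ks) = 0"
  by (simp add: t_star_sum_def)

lemma t_star_sum_Suc_Cons:
  "t_star_sum (Suc N) (k # ks) = t_star_sum N (k # ks) + t_star_sum (Suc N) ks / (2 * real N + 1) ^ k"
proof -
  have "weak_indices (Suc r) N \<inter> (#) (Suc N) ` weak_indices r (Suc N) = {}" for r
    by (auto simp: weak_indices_def)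
  then show ?thesis
    by (simp add: add.commute t_star_sum_def t_term_def weak_indices_Suc_Suc sum.union_disjoint sum.reindex
        prod.lessThan_Suc_shift sum_distrib_left sum_divide_distrib del: prod.lessThan_Suc)
qed

lemma t_sum_nonneg: "t_sum N ks \<ge> 0"
proof (induction ks arbitrary: N)
  case (Cons k ks)
  show ?case
    by (induction N) (auto simp: t_sum_Suc_Cons Cons.IH)
qed auto

lemma t_star_sum_nonneg: "t_star_sum N ks \<ge> 0"
proof (induction ks arbitrary: N)
  case (Cons k ks)
  show ?case
    by (induction N) (auto simp: t_star_sum_Suc_Cons Cons.IH)
qed auto

section \<open>Growth and convergence of nested sums\<close>

text \<open>The square root is a crude substitute for a power of the logarithm that is easy to
  propagate: summing \<open>1 / sqrt n\<close> gives a multiple of \<open>sqrt N\<close> again, at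
  the price of a factor 3 per position.\<close>

lemma nested_sum_bound:
  assumes "\<forall>w\<in>set ws. \<forall>n>0. \<bar>w n\<bar> \<le> 1 / real n"
  shows "\<bar>nested_sum N ws\<bar> \<le> 3 ^ length ws * sqrt (real N + 1)"
  using assms
proof (induction ws arbitrary: N)
  case (Cons w ws)
  show ?case
  proof (induction N)
    case (Suc N)
    have IH: "\<bar>nested_sum N ws\<bar> \<le> 3 ^ length ws * sqrt (real N + 1)"
      using Cons by simp
    have w: "\<bar>w (Suc N)\<bar> \<le> 1 / (real N + 1)"
      using Cons.prems by (auto simp: add.commute dest!: spec[of _ "Suc N"])
    have "\<bar>w (Suc N) * nested_sum N ws\<bar> \<le> 1 / (real N + 1) * (3 ^ length ws * sqrt (real N + 1))"
      unfolding abs_mult by (intro mult_mono IH w) auto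
    also have "\<dots> = 3 ^ length ws / sqrt (real N + 1)"
      using real_sqrt_mult_self[of "real N + 1"] by (simp add: divide_simps del: real_sqrt_mult_self)
    also have "\<dots> \<le> 3 ^ length ws * (3 * (sqrt (real N + 2) - sqrt (real N + 1)))"
    proof -
      have "sqrt (real N + 2) \<le> sqrt (4 * (real N + 1))"
        by (rule real_sqrt_le_mono) simp
      then have "sqrt (real N + 2) \<le> 2 * sqrt (real N + 1)"
        by (simp only: real_sqrt_mult) simp
      \<comment> \<open>The left-hand side equals 1, and the sum of the two roots is at most
        \<open>3 * sqrt (real N + 1)\<close>.\<close>
      then have "(sqrt (real N + 2) - sqrt (real N + 1)) * (sqrt (real N + 2) + sqrt (real N + 1))
          \<le> (sqrt (real N + 2) - sqrt (real N + 1)) * (3 * sqrt (real N + 1))"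
        by (intro mult_left_mono) auto
      then have "1 / sqrt (real N + 1) \<le> 3 * (sqrt (real N + 2) - sqrt (real N + 1))"
        by (simp add: field_simps)
      then have "3 ^ length ws * (1 / sqrt (real N + 1))
          \<le> 3 ^ length ws * (3 * (sqrt (real N + 2) - sqrt (real N + 1)))"
        by (intro mult_left_mono) auto
      then show ?thesis by simp
    qed
    finally show ?case using Suc
      unfolding nested_sum_Suc_Cons by (simp add: algebra_simps)
  qed auto
qed auto

text \<open>A quadratically decaying weight against growth of order \<open>sqrt n\<close> leaves
  terms of order \<open>n powr (-3/2)\<close>.\<close>

lemma summable_weight_nested_sum:
  assumes "\<forall>w\<in>set ws. \<forall>n>0. \<bar>w n\<bar> \<le> 1 / real n"
    and "\<And>n. \<bar>w (Suc n)\<bar> \<le> C / (real n + 1)\<^sup>2"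
  shows "summable (\<lambda>n. w (Suc n) * nested_sum n ws)"
proof (rule summable_comparison_test')
  have "summable (\<lambda>n. real (Suc n) powr (-3/2))"
    by (subst summable_Suc_iff) (simp add: summable_real_powr_iff)
  then show "summable (\<lambda>n. C * 3 ^ length ws * real (Suc n) powr (-3/2))"
    by (rule summable_mult)
  fix n :: nat
  have "norm (w (Suc n) * nested_sum n ws) \<le> C / (real n + 1)\<^sup>2 * (3 ^ length ws * sqrt (real n + 1))"
    unfolding real_norm_def abs_mult
    by (intro mult_mono assms(2) nested_sum_bound assms(1)) (auto intro: order.trans[OF _ assms(2)[of n]])
  also have "\<dots> = C * 3 ^ length ws * ((real n + 1) powr (1/2) / (real n + 1) powr 2)"
    by (simp add: powr_half_sqrt powr_realpow)
  also have "\<dots> = C * 3 ^ length ws * (real n + 1) powr (1/2 - 2)"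
    by (subst powr_diff) simp
  finally show "norm (w (Suc n) * nested_sum n ws) \<le> C * 3 ^ length ws * real (Suc n) powr (-3/2)"
    by (simp add: add.commute)
qed

lemma nested_sum_Cons_eq_sum:
  "nested_sum N (w # ws) = (\<Sum>n<N. w (Suc n) * nested_sum n ws)"
  by (induction N) (simp_all add: nested_sum_Suc_Cons)

lemma nested_sum_Cons_sums:
  assumes "\<forall>w\<in>set ws. \<forall>n>0. \<bar>w n\<bar> \<le> 1 / real n"
    and "\<And>n. \<bar>w (Suc n)\<bar> \<le> C / (real n + 1)\<^sup>2"
  shows "(\<lambda>N. nested_sum N (w # ws)) \<longlonglongrightarrow> (\<Sum>n. w (Suc n) * nested_sum n ws)"
  unfolding nested_sum_Cons_eq_sum
  using summable_LIMSEQ[OF summable_weight_nested_sum[of ws w C, OF assms]] .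

text \<open>For nonnegative terms any increasing exhaustion by finite sets computes the unordered
  sum: each finite subset of \<open>S\<close> lies in some \<open>F N\<close>, and each
  \<open>sum f (F N)\<close> is at most \<open>L\<close>.\<close>

lemma has_sum_exhaustion:
  fixes f :: "'a \<Rightarrow> real"
  assumes nonneg: "\<And>x. x \<in> S \<Longrightarrow> f x \<ge> 0"
    and fin: "\<And>N. finite (F N)" and mono: "incseq F" and S: "(\<Union>N. F N) = S"
    and lim: "(\<lambda>N. sum f (F N)) \<longlonglongrightarrow> L"
  shows "(f has_sum L) S"
proof -
  have le: "sum f (F N) \<le> L" for N
  proof (rule incseq_le[OF _ lim])
    show "incseq (\<lambda>N. sum f (F N))"
      using mono S by (auto simp: incseq_def intro!: sum_mono2 fin nonneg)
  qed
  show ?thesis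
    unfolding has_sum_def
  proof (rule order_tendstoI)
    fix a assume "a < L"
    then obtain N where N: "a < sum f (F N)"
      using order_tendstoD(1)[OF lim] by (auto simp: eventually_sequentially)
    have "a < sum f X" if "finite X" "F N \<subseteq> X" "X \<subseteq> S" for X
    proof -
      have "sum f (F N) \<le> sum f X"
        using that by (intro sum_mono2) (auto intro: nonneg)
      with N show ?thesis by simp
    qed
    moreover have "F N \<subseteq> S" using S by auto
    ultimately show "\<forall>\<^sub>F X in finite_subsets_at_top S. a < sum f X"
      using fin[of N] unfolding eventually_finite_subsets_at_top by blast
  next
    fix a assume a: "L < a"
    have "sum f X < a" if X: "finite X" "X \<subseteq> S" for X
    proof -
      have "\<exists>N. X \<subseteq> F N" using X
      proof (induction rule: finite_induct)
        case (insert x X)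
        then obtain N M where "X \<subseteq> F N" "x \<in> F M" using S by blast
        moreover have "F N \<subseteq> F (max N M)" "F M \<subseteq> F (max N M)"
          using mono by (auto simp: incseq_def)
        ultimately show ?case by blast
      qed auto
      then obtain N where "X \<subseteq> F N" by blast
      then have "sum f X \<le> sum f (F N)"
        using S by (intro sum_mono2 fin) (auto intro: nonneg)
      with le[of N] a show ?thesis by simp
    qed
    then show "\<forall>\<^sub>F X in finite_subsets_at_top S. sum f X < a"
      by (intro eventually_finite_subsets_at_top_weakI) auto
  qed
qed

text \<open>Connects the unordered sum in \<open>mtv\<close> with the truncated sums, for which
  recursions are available. The tuples with bounded largest index exhaust the index set.\<close>

lemma mtv_eqI:
  assumes "(\<lambda>N. t_sum N s) \<longlonglongrightarrow> L"
  shows "mtv s = L"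
proof -
  have "(t_term s has_sum L) {ns. length ns = length s \<and> sorted_wrt (>) ns \<and> 0 \<notin> set ns}"
  proof (rule has_sum_exhaustion)
    show "t_term s ns \<ge> 0"
      if "ns \<in> {ns. length ns = length s \<and> sorted_wrt (>) ns \<and> 0 \<notin> set ns}" for ns
      unfolding t_term_def
    proof (intro prod_nonneg ballI)
      fix j assume "j \<in> {..<length s}"
      then have "ns ! j \<noteq> 0" using that nth_mem[of j ns] by (cases "ns ! j = 0") auto
      then show "0 \<le> 1 / (2 * real (ns ! j) - 1) ^ s ! j"
        by (cases "ns ! j") auto
    qed
    show "incseq (strict_indices (length s))"
      by (auto simp: incseq_def dest: strict_indices_mono)
    show "(\<Union>N. strict_indices (length s) N) = {ns. length ns = length s \<and> sorted_wrt (>) ns \<and> 0 \<notin> set ns}"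
    proof -
      \<comment> \<open>Every tuple is bounded by its maximum; inserting 0 covers the empty
        tuple.\<close>
      have "set ns \<subseteq> {1..Max (insert 0 (set ns))}" if "0 \<notin> set ns" for ns :: "nat list"
      proof
        fix x assume x: "x \<in> set ns"
        then have "x \<le> Max (insert 0 (set ns))" by (intro Max_ge) auto
        moreover have "x \<noteq> 0" using x that by metis
        ultimately show "x \<in> {1..Max (insert 0 (set ns))}" by simp
      qed
      moreover have "0 \<notin> set ns" if "set ns \<subseteq> {1..N}" for ns and N :: nat
        using that by auto
      ultimately show ?thesis
        unfolding strict_indices_def by blast
    qed
    show "(\<lambda>N. sum (t_term s) (strict_indices (length s) N)) \<longlonglongrightarrow> L"
      using assms by (simp add: t_sum_def[abs_def])
  qed auto
  then show ?thesis
    by (simp add: mtv_def infsumI)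
qed

lemma odd_weight_bounds:
  assumes "k > 0"
  shows "n > 0 \<Longrightarrow> \<bar>1 / (2 * real n - 1) ^ k\<bar> \<le> 1 / real n"
proof -
  assume n: "n > 0"
  have "real n \<le> (2 * real n - 1) ^ 1" using n by (cases n) auto
  also have "\<dots> \<le> (2 * real n - 1) ^ k"
    using assms n by (intro power_increasing) auto
  finally show ?thesis using n by (simp add: divide_simps abs_of_pos)
qed

text \<open>The series is grouped by its largest index \<open>n + 1\<close>, which leaves a tail
  bounded by \<open>n\<close>. A head exponent of at least 2 gives the quadratic decay that ensures
  convergence.\<close>

lemma mtv_Cons_sums:
  assumes "a \<ge> 2" "0 \<notin> set s"
  shows "(\<lambda>n. t_sum n s / (2 * real n + 1) ^ a) sums mtv (a # s)"
proof -
  define ws where "ws = map (\<lambda>k n. 1 / (2 * real n - 1) ^ k) s"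
  define w where "w = (\<lambda>n. 1 / (2 * real n - 1) ^ a)"
  have ws: "\<forall>v\<in>set ws. \<forall>n>0. \<bar>v n\<bar> \<le> 1 / real n"
    unfolding ws_def set_map ball_simps
  proof (intro ballI allI impI)
    fix k n :: nat assume "k \<in> set s" "n > 0"
    then show "\<bar>1 / (2 * real n - 1) ^ k\<bar> \<le> 1 / real n"
      using assms by (intro odd_weight_bounds) (auto intro!: gr0I)
  qed
  have w: "\<bar>w (Suc n)\<bar> \<le> 1 / (real n + 1)\<^sup>2" for n
  proof -
    have "(real n + 1)\<^sup>2 \<le> (2 * real n + 1)\<^sup>2"
      by (intro power_mono) auto
    also have "\<dots> \<le> (2 * real n + 1) ^ a"
      using assms by (intro power_increasing) auto
    finally show ?thesis
      by (simp add: w_def add.commute frac_le)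
  qed
  have s: "t_sum n s / (2 * real n + 1) ^ a = w (Suc n) * nested_sum n ws" for n
    by (simp add: ws_def w_def t_sum_conv_nested_sum add.commute)
  have "(\<lambda>N. t_sum N (a # s)) \<longlonglongrightarrow> (\<Sum>n. w (Suc n) * nested_sum n ws)"
    using nested_sum_Cons_sums[of ws w 1, OF ws w]
    by (simp add: t_sum_conv_nested_sum[abs_def] ws_def w_def)
  then have "mtv (a # s) = (\<Sum>n. w (Suc n) * nested_sum n ws)"
    by (rule mtv_eqI)
  then show ?thesis
    unfolding s using summable_sums[OF summable_weight_nested_sum[of ws w 1, OF ws w]] by simp
qed

section \<open>Multiple t-values as alternating multiple zeta values\<close>

definition sign_lists :: "nat \<Rightarrow> real list set" where
  "sign_lists r = {es. set es \<subseteq> {1, -1} \<and> length es = r}"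

lemma sign_lists_0 [simp]: "sign_lists 0 = {[]}"
  by (auto simp: sign_lists_def)

lemma finite_sign_lists [simp]: "finite (sign_lists r)"
  unfolding sign_lists_def by (rule finite_lists_length_eq) auto

lemma sign_lists_Suc: "sign_lists (Suc r) = (#) 1 ` sign_lists r \<union> (#) (-1) ` sign_lists r"
  by (auto simp: sign_lists_def length_Suc_conv image_iff)

lemma sum_sign_lists_Suc:
  "(\<Sum>es\<in>sign_lists (Suc r). f es)
     = (\<Sum>es\<in>sign_lists r. f (1 # es)) + (\<Sum>es\<in>sign_lists r. f (-1 # es))"
proof -
  have "(#) (1::real) ` sign_lists r \<inter> (#) (-1) ` sign_lists r = {}"
    by auto
  then show ?thesis
    unfolding sign_lists_Suc by (simp add: sum.union_disjoint sum.reindex)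
qed

lemma alt_mzv_sum_Suc_Cons:
  assumes "length es = length ks"
  shows "alt_mzv_sum (Suc N) (k # ks) (e # es)
     = alt_mzv_sum N (k # ks) (e # es) + e ^ Suc N / real (Suc N) ^ k * alt_mzv_sum N ks es"
  using assms by (simp add: alt_mzv_sum_conv_nested_sum nested_sum_Suc_Cons)

text \<open>Only odd indices survive, since \<open>(\<Sum>\<epsilon>=\<plusminus>1. \<epsilon> * \<epsilon> ^ n)\<close> is 2 for odd \<open>n\<close> and 0 for even \<open>n\<close>.\<close>

lemma sum_signs_alt_mzv_sum:
  "(\<Sum>es\<in>sign_lists (length ks). prod_list es * alt_mzv_sum (2 * N) ks es)
     = 2 ^ length ks * t_sum N ks"
proof (induction ks arbitrary: N)
  case Nil
  show ?case by (simp add: alt_mzv_sum_conv_nested_sum)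
next
  case (Cons k ks)
  let ?L = "\<lambda>N ks. \<Sum>es\<in>sign_lists (length ks). prod_list es * alt_mzv_sum N ks es"
  \<comment> \<open>The two signs at the head contribute \<open>1\<close> and
    \<open>- (-1) ^ Suc M\<close> to the factor of the new summand.\<close>
  have step: "?L (Suc M) (k # ks) = ?L M (k # ks) + (1 - (-1) ^ Suc M) / real (Suc M) ^ k * ?L M ks" for M
  proof -
    have 1: "(\<Sum>es\<in>sign_lists (length ks). prod_list (e # es) * alt_mzv_sum (Suc M) (k # ks) (e # es))
       = (\<Sum>es\<in>sign_lists (length ks). prod_list (e # es) * alt_mzv_sum M (k # ks) (e # es))
         + e * e ^ Suc M / real (Suc M) ^ k * ?L M ks" for e
      unfolding sum_distrib_left sum.distrib[symmetric]
    proof (rule sum.cong)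
      fix es assume "es \<in> sign_lists (length ks)"
      then have "length es = length ks" by (simp add: sign_lists_def)
      then show "prod_list (e # es) * alt_mzv_sum (Suc M) (k # ks) (e # es)
        = prod_list (e # es) * alt_mzv_sum M (k # ks) (e # es)
          + e * e ^ Suc M / real (Suc M) ^ k * (prod_list es * alt_mzv_sum M ks es)"
        by (simp only: alt_mzv_sum_Suc_Cons prod_list.Cons ring_distribs times_divide_eq_left times_divide_eq_right mult_ac)
    qed simp
    show ?thesis
      unfolding length_Cons sum_sign_lists_Suc 1 by (simp only: mult_minus_left mult_1) (simp add: field_simps)
  qed
  show ?case
  proof (induction N)
    case 0
    have "alt_mzv_sum 0 (k # ks) es = 0" for es
      by (simp add: alt_mzv_sum_def)
    then show ?case by simp
  next
    case (Suc N)
    \<comment> \<open>The even index \<open>2 * N + 2\<close> adds nothing. The odd index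
      \<open>2 * N + 1\<close> adds a term whose tail has bound \<open>2 * N\<close>, to which the
      outer induction hypothesis applies.\<close>
    have "?L (2 * Suc N) (k # ks) = ?L (Suc (2 * N)) (k # ks)"
      using step[of "Suc (2 * N)"] by simp
    also have "\<dots> = 2 ^ length (k # ks) * t_sum N (k # ks)
        + 2 / real (Suc (2 * N)) ^ k * (2 ^ length ks * t_sum N ks)"
      using step[of "2 * N"] Suc Cons.IH[of N] by simp
    finally show ?case
      by (simp add: t_sum_Suc_Cons algebra_simps)
  qed
qed

text \<open>\<open>alt_mzv\<close> is defined by \<open>lim\<close>, so existence of the limit must
  be shown before it can be used. Signs do not affect absolute values, and the head exponent
  supplies the decay.\<close>

lemma alt_mzv_sum_convergent:
  assumes "a \<ge> 2" "0 \<notin> set s" "es \<in> sign_lists (length (a # s))"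
  shows "(\<lambda>N. alt_mzv_sum N (a # s) es) \<longlonglongrightarrow> alt_mzv (a # s) es"
proof -
  obtain e es' where es: "es = e # es'" "e \<in> {1, -1}" "es' \<in> sign_lists (length s)"
    using assms(3) by (cases es) (auto simp: sign_lists_def)
  have len: "length es' = length s" using es by (simp add: sign_lists_def)
  let ?ws = "map2 (\<lambda>k e n. e ^ n / real n ^ k) s es'"
  have abs1: "\<bar>e ^ n / real n ^ k\<bar> = 1 / real n ^ k" if "e \<in> {1, -1}" for e :: real and n k :: nat
    using that by (auto simp: power_abs abs_divide)
  have ws: "\<forall>w\<in>set ?ws. \<forall>n>0. \<bar>w n\<bar> \<le> 1 / real n"
  proof (intro ballI allI impI)
    fix w and n :: nat assume "w \<in> set ?ws" and n: "n > 0"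
    then obtain k e where "(k, e) \<in> set (zip s es')" and w: "w = (\<lambda>n. e ^ n / real n ^ k)"
      by auto
    then have "k \<in> set s" "e \<in> set es'" by (auto dest: set_zip_leftD set_zip_rightD)
    then have e: "e \<in> {1, -1}" and k: "k \<ge> 1" using es(3) assms(2)
      by (auto simp: sign_lists_def Suc_le_eq intro!: gr0I)
    have "real n ^ 1 \<le> real n ^ k" using n k by (intro power_increasing) auto
    then show "\<bar>w n\<bar> \<le> 1 / real n"
      unfolding w abs1[OF e] using n by (simp add: frac_le)
  qed
  have w: "\<bar>e ^ Suc n / real (Suc n) ^ a\<bar> \<le> 1 / (real n + 1)\<^sup>2" for n
  proof -
    have "real (Suc n) ^ 2 \<le> real (Suc n) ^ a"
      using assms by (intro power_increasing) auto
    then show ?thesis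
      unfolding abs1[OF es(2)] by (simp add: frac_le add.commute)
  qed
  have "convergent (\<lambda>N. alt_mzv_sum N (a # s) es)"
    unfolding convergent_def
    using nested_sum_Cons_sums[of ?ws "\<lambda>n. e ^ n / real n ^ a" 1, OF ws w] len
    by (auto simp: alt_mzv_sum_conv_nested_sum es(1))
  then show ?thesis
    by (simp add: alt_mzv_def convergent_LIMSEQ_iff)
qed

text \<open>This is \<open>sum_signs_alt_mzv_sum\<close> divided by the power of 2, in the limit;
  the alternating sums are taken along the subsequence of even bounds.\<close>

lemma mtv_eq_alt_mzv:
  assumes "a \<ge> 2" "0 \<notin> set s"
  shows "mtv (a # s) = (\<Sum>es\<in>sign_lists (length (a # s)).
     prod_list es / 2 ^ length (a # s) * alt_mzv (a # s) es)"
proof (rule mtv_eqI)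
  let ?r = "length (a # s)"
  have "t_sum N (a # s) = (\<Sum>es\<in>sign_lists ?r. prod_list es / 2 ^ ?r * alt_mzv_sum (2 * N) (a # s) es)" for N
    using sum_signs_alt_mzv_sum[of N "a # s"]
    by (simp del: length_Cons add: field_simps flip: sum_divide_distrib)
  moreover have "(\<lambda>N. alt_mzv_sum (2 * N) (a # s) es) \<longlonglongrightarrow> alt_mzv (a # s) es"
    if "es \<in> sign_lists ?r" for es
    using LIMSEQ_subseq_LIMSEQ[OF alt_mzv_sum_convergent[OF assms that], of "\<lambda>N. 2 * N"]
    by (simp add: o_def strict_mono_def)
  ultimately show "(\<lambda>N. t_sum N (a # s)) \<longlonglongrightarrow>
     (\<Sum>es\<in>sign_lists ?r. prod_list es / 2 ^ ?r * alt_mzv (a # s) es)"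
    by (simp only:) (intro tendsto_sum tendsto_mult tendsto_const)
qed

text \<open>The coefficients in \<open>mtv_eq_alt_mzv\<close> are rational, so each generator of the
  smaller span lies in the larger one. A positive weight ensures that the composition has a
  head.\<close>

lemma MtV_subset_CMZV2:
  assumes "w > 0"
  shows "MtV w \<subseteq> CMZV2 w"
proof -
  interpret vector_space "\<lambda>(q::rat) (x::real). of_rat q * x"
    by (rule vector_space_rat_real)
  let ?A = "{alt_mzv ks es | ks es. ks \<in> compositions w \<and> length es = length ks
     \<and> set es \<subseteq> {1, -1} \<and> (ks = [] \<or> (hd ks, hd es) \<noteq> (1, 1))}"
  have rat: "\<exists>q. prod_list es / 2 ^ r = of_rat q" if "set es \<subseteq> {1, -1}" for es :: "real list" and r :: nat
    using that
  proof (induction es)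
    case Nil
    have "prod_list [] / 2 ^ r = (of_rat (1 / 2 ^ r) :: real)"
      by (simp add: of_rat_divide of_rat_power)
    then show ?case by blast
  next
    case (Cons e es)
    then obtain q where "prod_list es / 2 ^ r = of_rat q" by auto
    then have "prod_list (e # es) / 2 ^ r = of_rat (if e = 1 then q else - q)"
      using Cons.prems by (auto simp: of_rat_minus)
    then show ?case by blast
  qed
  have "mtv s \<in> span ?A" if s: "s \<in> compositions w" "s = [] \<or> hd s \<ge> 2" for s
  proof -
    obtain a s' where as: "s = a # s'" "a \<ge> 2" "0 \<notin> set s'"
      using s assms by (cases s) (auto simp: compositions_def)
    have "prod_list es / 2 ^ length s * alt_mzv s es \<in> span ?A" if "es \<in> sign_lists (length s)" for es
    proof -
      have "set es \<subseteq> {1, -1}" using that by (simp add: sign_lists_def)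
      from rat[OF this] obtain q where q: "prod_list es / 2 ^ length s = of_rat q" by blast
      \<comment> \<open>The head exponent is at least 2, so the pair \<open>(1, 1)\<close> cannot
        occur, whatever the signs are.\<close>
      have "alt_mzv s es \<in> ?A"
        using that s as unfolding mem_Collect_eq
        by (intro exI[of _ s] exI[of _ es]) (auto simp: sign_lists_def)
      then show ?thesis
        unfolding q by (intro span_scale span_base)
    qed
    then show ?thesis
      using mtv_eq_alt_mzv[OF as(2,3)] unfolding as(1) by (simp only: span_sum)
  qed
  then show ?thesis
    unfolding MtV_def CMZV2_def rat_span_def by (intro span_minimal) auto
qed

section \<open>Weighted sums of multiple t-values\<close>

lemma compositions_0 [simp]: "compositions 0 = {[]}"
proof -
  have "ks = []" if "0 \<notin> set ks" "sum_list ks = 0" for ks :: "nat list"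
    using that by (cases ks) auto
  then show ?thesis by (auto simp: compositions_def)
qed

lemma compositions_conv_UN:
  "l > 0 \<Longrightarrow> compositions l = (\<Union>k\<in>{1..l}. (#) k ` compositions (l - k))"
proof (intro equalityI subsetI)
  fix s assume "l > 0" "s \<in> compositions l"
  then obtain k s' where "s = k # s'" "k \<ge> 1" "k + sum_list s' = l" "0 \<notin> set s'"
    by (cases s) (auto simp: compositions_def Suc_le_eq)
  then show "s \<in> (\<Union>k\<in>{1..l}. (#) k ` compositions (l - k))"
    by (auto simp: compositions_def intro!: bexI[of _ k])
qed (auto simp: compositions_def)

lemma finite_compositions [simp]: "finite (compositions l)"
proof (induction l rule: less_induct)
  case (less l)
  then show ?case
    by (cases "l = 0") (auto simp: compositions_conv_UN)
qed

lemma sum_compositions: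
  assumes "l > 0"
  shows "(\<Sum>s\<in>compositions l. f s) = (\<Sum>k=1..l. \<Sum>s\<in>compositions (l - k). f (k # s))"
proof -
  have "(\<Sum>s\<in>compositions l. f s) = (\<Sum>k=1..l. \<Sum>s\<in>(#) k ` compositions (l - k). f s)"
    unfolding compositions_conv_UN[OF assms] by (rule sum.UNION_disjoint) auto
  then show ?thesis by (simp add: sum.reindex)
qed

section \<open>Generating functions over strings of ones\<close>

definition t_fps :: "nat \<Rightarrow> real fps" where
  "t_fps n = Abs_fps (\<lambda>k. t_sum n (ones k))"

definition t_star_fps :: "nat \<Rightarrow> real fps" where
  "t_star_fps n = Abs_fps (\<lambda>k. t_star_sum n (ones k))"

text \<open>The powers of 2 make this the product of \<open>(1 + c * X) / (1 - c * X)\<close> over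
  \<open>c = 1 / (2 * j + 1)\<close> with \<open>j < n\<close>.\<close>

definition t_weighted_fps :: "nat \<Rightarrow> real fps" where
  "t_weighted_fps n = Abs_fps (\<lambda>l. \<Sum>s\<in>compositions l. 2 ^ length s * t_sum n s)"

definition geom_fps :: "real \<Rightarrow> real fps" where
  "geom_fps c = Abs_fps (\<lambda>k. c ^ k)"

lemma fps_mult_linear_nth:
  fixes f :: "'a::comm_ring_1 fps"
  shows "(f * (1 + fps_const c * fps_X)) $ k = f $ k + (if k = 0 then 0 else c * f $ (k - 1))"
proof -
  have "f * (1 + fps_const c * fps_X) = f + fps_const c * (f * fps_X)"
    by (simp add: distrib_left mult.left_commute)
  then show ?thesis by simp
qed

lemma geom_fps_eq: "geom_fps c * (1 + fps_const (-c) * fps_X) = 1"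
proof (rule fps_ext)
  fix k show "(geom_fps c * (1 + fps_const (-c) * fps_X)) $ k = (1 :: real fps) $ k"
    unfolding fps_mult_linear_nth by (cases k) (simp_all add: geom_fps_def)
qed

lemma fps_eq_0_recursion:
  assumes "f 0 = (1::real)" "\<And>k. f (Suc k) = 0"
  shows "Abs_fps f = 1"
  by (rule fps_ext) (metis assms fps_nth_Abs_fps fps_one_nth not0_implies_Suc)

lemma t_fps_0: "t_fps 0 = 1" and t_star_fps_0: "t_star_fps 0 = 1"
  unfolding t_fps_def t_star_fps_def by (rule fps_eq_0_recursion; simp)+

lemma t_weighted_fps_0: "t_weighted_fps 0 = 1"
  unfolding t_weighted_fps_def
  by (rule fps_eq_0_recursion) (simp_all add: sum_compositions)

lemma t_fps_Suc: "t_fps (Suc n) = t_fps n * (1 + fps_const (1 / (2 * real n + 1)) * fps_X)"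
proof (rule fps_ext)
  fix k show "t_fps (Suc n) $ k = (t_fps n * (1 + fps_const (1 / (2 * real n + 1)) * fps_X)) $ k"
    unfolding fps_mult_linear_nth by (cases k) (simp_all add: t_fps_def t_sum_Suc_Cons)
qed

text \<open>The recursion for \<open>t_star_sum\<close> keeps the bound \<open>Suc n\<close> in the
  tail. It therefore yields \<open>t_star_fps (Suc n) * L = t_star_fps n\<close> with a linear
  factor \<open>L\<close>, whose inverse is the geometric series.\<close>

lemma t_star_fps_Suc: "t_star_fps (Suc n) = t_star_fps n * geom_fps (1 / (2 * real n + 1))"
proof -
  define L where "L = 1 + fps_const (- (1 / (2 * real n + 1))) * fps_X"
  have "t_star_fps (Suc n) * L = t_star_fps n"
  proof (rule fps_ext)
    fix k show "(t_star_fps (Suc n) * L) $ k = t_star_fps n $ k"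
      unfolding L_def fps_mult_linear_nth
      by (cases k) (simp_all add: t_star_fps_def t_star_sum_Suc_Cons)
  qed
  moreover have geom: "geom_fps (1 / (2 * real n + 1)) * L = 1"
    unfolding L_def by (rule geom_fps_eq)
  ultimately have "t_star_fps (Suc n) * (geom_fps (1 / (2 * real n + 1)) * L)
      = t_star_fps n * geom_fps (1 / (2 * real n + 1))"
    by (metis mult.assoc mult.commute)
  then show ?thesis
    by (simp only: geom mult_1_right)
qed

lemma t_weighted_fps_Suc:
  "t_weighted_fps (Suc n) =
     t_weighted_fps n * (geom_fps (1 / (2 * real n + 1)) + geom_fps (1 / (2 * real n + 1)) - 1)"
proof (rule fps_ext)
  fix l
  define c where "c = 1 / (2 * real n + 1)"
  have 0: "t_weighted_fps N $ 0 = 1" for N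
    by (simp add: t_weighted_fps_def)
  have "t_weighted_fps (Suc n) $ l
     = t_weighted_fps n $ l + (\<Sum>k=1..l. c ^ k * t_weighted_fps n $ (l - k))
       + (\<Sum>k=1..l. c ^ k * t_weighted_fps n $ (l - k))"
  proof (cases "l = 0")
    case False
    have "t_weighted_fps (Suc n) $ l
       = (\<Sum>k=1..l. \<Sum>s\<in>compositions (l - k). 2 ^ length (k # s) * t_sum n (k # s)
            + 2 * c ^ k * (2 ^ length s * t_sum n s))"
      using False by (simp add: t_weighted_fps_def sum_compositions t_sum_Suc_Cons
          distrib_left c_def power_divide mult.assoc)
    also have "\<dots> = (\<Sum>s\<in>compositions l. 2 ^ length s * t_sum n s)
       + (\<Sum>k=1..l. 2 * c ^ k * (\<Sum>s\<in>compositions (l - k). 2 ^ length s * t_sum n s))"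
      using False by (simp only: sum.distrib sum_distrib_left sum_compositions gr0I)
    finally show ?thesis
      by (simp add: t_weighted_fps_def mult.assoc flip: sum_distrib_left)
  qed (simp add: 0)
  also have "\<dots> = (\<Sum>k=0..l. c ^ k * t_weighted_fps n $ (l - k))
       + (\<Sum>k=0..l. c ^ k * t_weighted_fps n $ (l - k)) - t_weighted_fps n $ l"
    by (simp add: sum.atLeast_Suc_atMost[of 0 l])
  also have "\<dots> = (geom_fps c * t_weighted_fps n + geom_fps c * t_weighted_fps n - t_weighted_fps n) $ l"
    unfolding fps_sub_nth fps_add_nth fps_mult_nth geom_fps_def fps_nth_Abs_fps ..
  finally show "t_weighted_fps (Suc n) $ l = (t_weighted_fps n *
      (geom_fps (1 / (2 * real n + 1)) + geom_fps (1 / (2 * real n + 1)) - 1)) $ l"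
    unfolding c_def[symmetric] by (simp only: right_diff_distrib distrib_left mult_1_left mult_1_right mult.commute)
qed

lemma t_fps_mult_t_star_fps: "t_fps n * t_star_fps n = t_weighted_fps n"
proof (induction n)
  case (Suc n)
  define c where "c = fps_const (1 / (2 * real n + 1)) * fps_X"
  define g where "g = geom_fps (1 / (2 * real n + 1))"
  have "g * (1 - c) = 1"
    using geom_fps_eq[of "1 / (2 * real n + 1)"]
    by (simp add: g_def c_def flip: fps_const_neg)
  then have *: "(1 + c) * g = g + g - 1"
    by (simp add: algebra_simps)
  have "t_fps (Suc n) * t_star_fps (Suc n) = (t_fps n * t_star_fps n) * ((1 + c) * g)"
    unfolding t_fps_Suc t_star_fps_Suc c_def g_def by (simp only: mult_ac)
  also have "\<dots> = t_weighted_fps (Suc n)"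
    unfolding * Suc.IH t_weighted_fps_Suc by (simp only: g_def)
  finally show ?case .
qed (simp add: t_fps_0 t_star_fps_0 t_weighted_fps_0)

text \<open>The bound of the star sum exceeds that of the strict sum by one, which leaves one extra
  geometric factor. Its exponent \<open>i\<close> later becomes part of the largest index's
  exponent.\<close>

lemma sum_t_sum_t_star_sum:
  "(\<Sum>k=0..m. t_sum n (ones k) * t_star_sum (Suc n) (ones (m - k)))
    = (\<Sum>i=0..m. \<Sum>s\<in>compositions (m - i). 2 ^ length s * (t_sum n s / (2 * real n + 1) ^ i))"
proof -
  have "t_fps n * t_star_fps (Suc n) = geom_fps (1 / (2 * real n + 1)) * t_weighted_fps n"
    unfolding t_star_fps_Suc t_fps_mult_t_star_fps[symmetric] by (simp only: mult_ac)
  then have "(t_fps n * t_star_fps (Suc n)) $ m = (geom_fps (1 / (2 * real n + 1)) * t_weighted_fps n) $ m"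
    by simp
  then show ?thesis
    by (simp add: fps_mult_nth t_fps_def t_star_fps_def t_weighted_fps_def geom_fps_def
        sum_distrib_left power_divide mult.commute)
qed

text \<open>Division by the square turns the exponent \<open>i\<close> into a head
  \<open>i + 2\<close>, and \<open>i\<close> ranges over all heads of at least 2 as the rest runs
  through compositions of \<open>m - i\<close>. With the rest of length \<open>d - 1\<close>, the
  power of 2 is the desired one.\<close>

lemma sum_sums_mtv:
  "(\<lambda>n. \<Sum>k=0..m. t_sum n (ones k) * t_star_sum (n + 1) (ones (m - k)) / (2 * real n + 1)\<^sup>2)
     sums (\<Sum>d=1..m+1. \<Sum>s\<in>{s \<in> compositions (m + 2). length s = d \<and> hd s \<ge> 2}. 2 ^ (d - 1) * mtv s)"
proof -
  have sums: "(\<lambda>n. \<Sum>i=0..m. \<Sum>s\<in>compositions (m - i). 2 ^ length s * (t_sum n s / (2 * real n + 1) ^ (i + 2)))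
     sums (\<Sum>i=0..m. \<Sum>s\<in>compositions (m - i). 2 ^ length s * mtv ((i + 2) # s))"
    by (intro sums_sum sums_mult mtv_Cons_sums) (auto simp: compositions_def)
  have "(\<Sum>i=0..m. \<Sum>s\<in>compositions (m - i). 2 ^ length s * mtv ((i + 2) # s))
     = (\<Sum>k=2..m+2. \<Sum>s\<in>compositions (m + 2 - k). 2 ^ length s * mtv (k # s))"
    using sum.shift_bounds_cl_nat_ivl[of "\<lambda>k. \<Sum>s\<in>compositions (m + 2 - k). 2 ^ length s * mtv (k # s)" 0 2 m]
    by (simp add: numeral_2_eq_2)
  also have "\<dots> = (\<Sum>s\<in>compositions (m + 2). if hd s \<ge> 2 then 2 ^ (length s - 1) * mtv s else 0)"
  proof -
    have "(\<Sum>s\<in>compositions (m + 2). if hd s \<ge> 2 then 2 ^ (length s - 1) * mtv s else 0)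
      = (\<Sum>k=1..m+2. \<Sum>s\<in>compositions (m + 2 - k). if k \<ge> 2 then 2 ^ length s * mtv (k # s) else 0)"
      using sum_compositions[of "m + 2" "\<lambda>s. if hd s \<ge> 2 then 2 ^ (length s - 1) * mtv s else 0"]
      by (simp only: list.sel length_Cons diff_Suc_1 add_2_eq_Suc' zero_less_Suc)
    also have "\<dots> = (\<Sum>k=2..m+2. \<Sum>s\<in>compositions (m + 2 - k). 2 ^ length s * mtv (k # s))"
      by (rule sum.mono_neutral_cong_right) auto
    finally show ?thesis ..
  qed
  also have "\<dots> = (\<Sum>s\<in>{s\<in>compositions (m + 2). hd s \<ge> 2}. 2 ^ (length s - 1) * mtv s)"
    by (rule sum.inter_filter[symmetric]) simp
  also have "\<dots> = (\<Sum>d=1..m+1. \<Sum>s\<in>{s \<in> {s\<in>compositions (m + 2). hd s \<ge> 2}. length s = d}. 2 ^ (length s - 1) * mtv s)"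
  proof (rule sum.group[symmetric])
    have len: "length s \<le> sum_list s" if "0 \<notin> set s" for s :: "nat list"
      using that by (induction s) (auto simp: Suc_le_eq)
    \<comment> \<open>The head takes at least 2 of the weight \<open>m + 2\<close> and every other
      part at least 1, so the depth is at most \<open>m + 1\<close>.\<close>
    show "length ` {s \<in> compositions (m + 2). 2 \<le> hd s} \<subseteq> {1..m + 1}"
    proof clarify
      fix s assume s: "s \<in> compositions (m + 2)" "2 \<le> hd s"
      then obtain a s' where "s = a # s'" by (cases s) (auto simp: compositions_def)
      with s len[of s'] show "length s \<in> {1..m + 1}" by (auto simp: compositions_def)
    qed
  qed auto
  also have "\<dots> = (\<Sum>d=1..m+1. \<Sum>s\<in>{s \<in> compositions (m + 2). length s = d \<and> hd s \<ge> 2}. 2 ^ (d - 1) * mtv s)"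
    by (intro sum.cong) auto
  finally have limit: "(\<Sum>i=0..m. \<Sum>s\<in>compositions (m - i). 2 ^ length s * mtv ((i + 2) # s))
     = (\<Sum>d=1..m+1. \<Sum>s\<in>{s \<in> compositions (m + 2). length s = d \<and> hd s \<ge> 2}. 2 ^ (d - 1) * mtv s)" .
  have terms: "(\<lambda>n. \<Sum>i=0..m. \<Sum>s\<in>compositions (m - i). 2 ^ length s * (t_sum n s / (2 * real n + 1) ^ (i + 2)))
     = (\<lambda>n. \<Sum>k=0..m. t_sum n (ones k) * t_star_sum (n + 1) (ones (m - k)) / (2 * real n + 1)\<^sup>2)"
  proof
    fix n
    have "(\<Sum>i=0..m. \<Sum>s\<in>compositions (m - i). 2 ^ length s * (t_sum n s / (2 * real n + 1) ^ (i + 2)))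
      = (\<Sum>i=0..m. \<Sum>s\<in>compositions (m - i). 2 ^ length s * (t_sum n s / (2 * real n + 1) ^ i))
          / (2 * real n + 1)\<^sup>2"
      by (simp only: sum_divide_distrib power_add times_divide_eq_right divide_divide_eq_left)
    also have "\<dots> = (\<Sum>k=0..m. t_sum n (ones k) * t_star_sum (n + 1) (ones (m - k)) / (2 * real n + 1)\<^sup>2)"
      by (simp only: sum_t_sum_t_star_sum[symmetric] sum_divide_distrib Suc_eq_plus1)
    finally show "(\<Sum>i=0..m. \<Sum>s\<in>compositions (m - i). 2 ^ length s * (t_sum n s / (2 * real n + 1) ^ (i + 2)))
     = (\<Sum>k=0..m. t_sum n (ones k) * t_star_sum (n + 1) (ones (m - k)) / (2 * real n + 1)\<^sup>2)" .
  qed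
  show ?thesis
    using sums unfolding limit terms .
qed

section \<open>Telescoping for the generating functions\<close>

definition cbin :: "nat \<Rightarrow> real" where
  "cbin n = 1 / 4 ^ n * real ((2 * n) choose n)"

text \<open>The generating function \<open>t_star_fps n\<close> evaluated at
  \<open>- y\<close>.\<close>

definition star_prod :: "nat \<Rightarrow> real \<Rightarrow> real" where
  "star_prod n y = (\<Prod>j<n. (2 * real j + 1) / (2 * real j + 1 + y))"

text \<open>The value at \<open>- y\<close> of the product of \<open>t_fps n\<close> and
  \<open>t_star_fps n\<close>.\<close>

definition quot_prod :: "nat \<Rightarrow> real \<Rightarrow> real" where
  "quot_prod n y = (\<Prod>j<n. (2 * real j + 1 - y) / (2 * real j + 1 + y))"

definition binom_term :: "real \<Rightarrow> nat \<Rightarrow> real" where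
  "binom_term y n = cbin n / (2 * real n + 1) * star_prod (Suc n) y"

text \<open>One of the two factors \<open>2 * n + 1\<close> of the squared denominator has cancelled
  against the last numerator in \<open>star_prod (Suc n) y\<close>.\<close>

definition square_term :: "real \<Rightarrow> nat \<Rightarrow> real" where
  "square_term y n = quot_prod n y / ((2 * real n + 1) * (2 * real n + 1 + y))"

lemma cbin_Suc: "cbin (Suc n) = cbin n * (2 * real n + 1) / (2 * real n + 2)"
proof -
  have "(2 * n + 1) choose n = (2 * n + 1) choose Suc n"
    using binomial_symmetric[of n "2 * n + 1"] by simp
  then have "Suc n * ((2 * Suc n) choose (Suc n)) = (2 * n + 2) * ((2 * n + 1) choose Suc n)"
    using Suc_times_binomial[of n "2 * n + 1"] by simp
  moreover have "Suc n * ((2 * n + 1) choose Suc n) = (2 * n + 1) * ((2 * n) choose n)"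
    using Suc_times_binomial[of n "2 * n"] by simp
  ultimately have "real (Suc n * ((2 * Suc n) choose (Suc n))) = real (2 * ((2 * n + 1) * ((2 * n) choose n)))"
    by (intro arg_cong[of _ _ real]) (simp add: algebra_simps)
  then have "(real n + 1) * real ((2 * Suc n) choose (Suc n)) = 2 * (2 * real n + 1) * real ((2 * n) choose n)"
    by (simp only: of_nat_mult of_nat_Suc of_nat_add of_nat_numeral of_nat_1 mult_ac add.commute)
  then have "real ((2 * Suc n) choose (Suc n)) = 2 * (2 * real n + 1) * real ((2 * n) choose n) / (real n + 1)"
    by (simp add: divide_simps mult_ac del: mult_Suc_right)
  then show ?thesis
    unfolding cbin_def by (simp del: mult_Suc_right add: divide_simps) (simp add: algebra_simps)
qed

lemma cbin_pos: "cbin n > 0"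
  by (simp add: cbin_def)

lemma star_prod_0 [simp]: "star_prod 0 y = 1"
  and star_prod_Suc: "star_prod (Suc n) y = star_prod n y * ((2 * real n + 1) / (2 * real n + 1 + y))"
  by (simp_all add: star_prod_def)

lemma quot_prod_0 [simp]: "quot_prod 0 y = 1"
  and quot_prod_Suc: "quot_prod (Suc n) y = quot_prod n y * ((2 * real n + 1 - y) / (2 * real n + 1 + y))"
  by (simp_all add: quot_prod_def)

lemma star_prod_pos: "y > -1 \<Longrightarrow> star_prod n y > 0"
  unfolding star_prod_def by (intro prod_pos) (auto intro!: divide_pos_pos add_nonneg_pos)

lemma star_prod_le: "y \<ge> 0 \<Longrightarrow> star_prod n y \<le> 1"
  unfolding star_prod_def by (intro prod_le_1) (auto simp: divide_simps)

lemma abs_quot_prod_le: "y \<ge> 0 \<Longrightarrow> \<bar>quot_prod n y\<bar> \<le> 1"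
  unfolding quot_prod_def abs_prod by (intro prod_le_1) (auto simp: divide_simps abs_if)

lemma binom_term_Suc:
  assumes "y > -1"
  shows "binom_term y (Suc n) = binom_term y n * (2 * real n + 1)\<^sup>2 / ((2 * real n + 2) * (2 * real n + 3 + y))"
  using assms
  by (simp add: binom_term_def star_prod_Suc[of "Suc n"] cbin_Suc power2_eq_square divide_simps)

lemma square_term_Suc:
  assumes "y > -1"
  shows "square_term y (Suc n) = square_term y n * ((2 * real n + 1) * (2 * real n + 1 - y))
     / ((2 * real n + 3) * (2 * real n + 3 + y))"
proof -
  have "2 * real n + 1 + y \<noteq> 0" "2 * real n + 3 + y \<noteq> 0" "2 * real n + 1 \<noteq> 0" "2 * real n + 3 \<noteq> 0"
    using assms by linarith+
  then show ?thesis
    by (simp add: square_term_def quot_prod_Suc divide_simps) (simp add: algebra_simps)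
qed

text \<open>Adding 2 to \<open>y\<close> moves every denominator to the next position, so only the
  first and the last survive in the quotient.\<close>

lemma star_prod_shift:
  assumes "y > -1"
  shows "star_prod n (y + 2) = star_prod n y * (1 + y) / (2 * real n + 1 + y)"
proof (induction n)
  case 0
  then show ?case using assms by simp
next
  case (Suc n)
  have "2 * real n + 1 + y \<noteq> 0" "2 * real n + 3 + y \<noteq> 0"
    using assms by linarith+
  then show ?case
    unfolding star_prod_Suc Suc by (simp add: divide_simps)
qed

text \<open>The denominators move one position forward and the numerators one backward; the
  numerator \<open>-1 - y\<close> entering at the front causes the minus sign. Excluding odd
  \<open>y\<close> keeps the cancelled factors nonzero.\<close>

lemma quot_prod_shift:
  assumes "y > -1" "\<And>j. y \<noteq> 2 * real j + 1"
  shows "quot_prod n (y + 2) = - quot_prod n y * (1 + y)\<^sup>2 / ((2 * real n - 1 - y) * (2 * real n + 1 + y))"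
proof (induction n)
  case 0
  then show ?case using assms by (simp add: power2_eq_square divide_simps)
next
  case (Suc n)
  have "2 * real n + 1 + y \<noteq> 0" "2 * real n + 3 + y \<noteq> 0"
    using assms by linarith+
  moreover have "2 * real n - 1 - y \<noteq> 0"
    using assms(1) assms(2)[of "n - 1"] by (cases n) auto
  moreover have "2 * real n + 1 - y \<noteq> 0"
    using assms(2)[of n] by auto
  ultimately show ?case
    unfolding quot_prod_Suc Suc by (simp add: divide_simps) (simp add: algebra_simps)
qed

text \<open>The certificate is \<open>2 * (1 + y) * n\<close>: all terms are rational multiples of
  \<open>binom_term y n\<close>, which reduces the claim to a polynomial identity.\<close>

lemma binom_term_telescope:
  assumes "y > -1"
  shows "(2 + y)\<^sup>2 * binom_term (y + 2) n - (1 + y)\<^sup>2 * binom_term y n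
    = 2 * (1 + y) * (real (Suc n) * binom_term y (Suc n) - real n * binom_term y n)"
proof -
  have nz: "2 * real n + 3 + y \<noteq> 0" "2 * real n + 2 \<noteq> 0"
    using assms by linarith+
  have 1: "binom_term (y + 2) n = binom_term y n * (1 + y) / (2 * real n + 3 + y)"
    by (simp add: binom_term_def star_prod_shift[OF assms] add_ac)
  have 2: "real (Suc n) * binom_term y (Suc n) = binom_term y n * (2 * real n + 1)\<^sup>2 / (2 * (2 * real n + 3 + y))"
    unfolding binom_term_Suc[OF assms] using nz by (simp add: divide_simps) (simp add: algebra_simps)
  show ?thesis
    unfolding 1 2 using nz by (simp add: divide_simps) (simp add: power2_eq_square algebra_simps)
qed

text \<open>Here \<open>w n\<close> is \<open>square_term y n\<close> times the rational certificate
  \<open>n * (2 * n + 1) / (2 * n - 1 - y)\<close>.\<close>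

lemma square_term_telescope:
  fixes y :: real
  assumes "y > -1" "\<And>j. y \<noteq> 2 * real j + 1"
  defines "w \<equiv> \<lambda>n. real n * quot_prod n y / ((2 * real n - 1 - y) * (2 * real n + 1 + y))"
  shows "(2 + y)\<^sup>2 * square_term (y + 2) n - (1 + y)\<^sup>2 * square_term y n = (1 + y) * (w (Suc n) - w n)"
proof -
  have nz: "2 * real n + 1 + y \<noteq> 0" "2 * real n + 3 + y \<noteq> 0" "2 * real n + 1 \<noteq> 0"
    using assms(1) by linarith+
  have nz2: "2 * real n - 1 - y \<noteq> 0"
    using assms(1) assms(2)[of "n - 1"] by (cases n) auto
  have nz3: "2 * real n + 1 - y \<noteq> 0"
    using assms(2)[of n] by auto
  have 1: "square_term (y + 2) n = - quot_prod n y * (1 + y)\<^sup>2 /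
      ((2 * real n - 1 - y) * (2 * real n + 1 + y) * (2 * real n + 1) * (2 * real n + 3 + y))"
    by (simp add: square_term_def quot_prod_shift[OF assms(1,2)] add_ac mult_ac)
  have 2: "w (Suc n) = real (Suc n) * quot_prod n y / ((2 * real n + 1 + y) * (2 * real n + 3 + y))"
    using nz nz3 by (simp add: w_def quot_prod_Suc add_ac divide_simps)
  show ?thesis
    unfolding 1 2 unfolding w_def square_term_def
    using nz nz2 by (simp add: divide_simps) (simp add: power2_eq_square algebra_simps)
qed

section \<open>Convergence in \<open>n\<close> and the recursion in \<open>y\<close>\<close>

lemma summable_ratio_asymp:
  fixes f :: "nat \<Rightarrow> real"
  assumes "\<And>n. f n > 0" "(\<lambda>n. real n * (f n / f (Suc n) - 1)) \<longlonglongrightarrow> l" "l > 1"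
  shows "summable f"
proof (rule raabes_test_convergence)
  have "(\<lambda>n. ereal (real n * (f n / f (Suc n) - 1))) \<longlonglongrightarrow> ereal l"
    using assms(2) by simp
  from lim_imp_Liminf[OF sequentially_bot this]
  show "liminf (\<lambda>n. ereal (real n * (f n / f (Suc n) - 1))) > 1"
    using assms(3) by simp
qed (use assms(1) in simp)

lemma binom_term_pos: "y > -1 \<Longrightarrow> binom_term y n > 0"
  unfolding binom_term_def by (intro mult_pos_pos divide_pos_pos cbin_pos star_prod_pos) auto

text \<open>Raabe's limit \<open>(3 + y) / 2\<close> exceeds 1 exactly for \<open>y > -1\<close>.
  Negative \<open>y\<close> matter because the coefficient comparison starts from convergence at a
  positive \<open>x = - y\<close>.\<close>

lemma summable_binom_term:
  assumes "y > -1"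
  shows "summable (binom_term y)"
proof (rule summable_ratio_asymp)
  have "binom_term y n / binom_term y (Suc n) = (2 * real n + 2) * (2 * real n + 3 + y) / (2 * real n + 1)\<^sup>2" for n
  proof -
    have "2 * real n + 3 + y \<noteq> 0" "2 * real n + 1 \<noteq> 0" "binom_term y n \<noteq> 0"
      using assms binom_term_pos[OF assms, of n] by linarith+
    then show ?thesis
      by (simp add: binom_term_Suc[OF assms])
  qed
  moreover have "(\<lambda>n. real n * ((2 * real n + 2) * (2 * real n + 3 + y) / (2 * real n + 1)\<^sup>2 - 1))
     \<longlonglongrightarrow> (3 + y) / 2"
    by (real_asymp simp: field_simps)
  ultimately show "(\<lambda>n. real n * (binom_term y n / binom_term y (Suc n) - 1)) \<longlonglongrightarrow> (3 + y) / 2"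
    by simp
qed (use assms binom_term_pos in auto)

text \<open>In this range all terms are positive, so Raabe's test applies, with limit
  \<open>2 + y\<close>. Nonnegative \<open>y\<close> are handled by comparison with the case
  \<open>y = 0\<close>.\<close>

lemma summable_square_term_neg:
  assumes "-1 < y" "y \<le> 0"
  shows "summable (square_term y)"
proof (rule summable_ratio_asymp)
  show pos: "square_term y n > 0" for n
    unfolding square_term_def quot_prod_def using assms
    by (intro divide_pos_pos mult_pos_pos prod_pos) auto
  have "square_term y n / square_term y (Suc n)
     = (2 * real n + 3) * (2 * real n + 3 + y) / ((2 * real n + 1) * (2 * real n + 1 - y))" for n
  proof -
    have "2 * real n + 3 + y \<noteq> 0" "2 * real n + 1 - y \<noteq> 0" "square_term y n \<noteq> 0"
      using assms pos[of n] by linarith+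
    then show ?thesis
      by (simp add: square_term_Suc[OF assms(1)])
  qed
  moreover have "(\<lambda>n. real n * ((2 * real n + 3) * (2 * real n + 3 + y) / ((2 * real n + 1) * (2 * real n + 1 - y)) - 1))
     \<longlonglongrightarrow> 2 + y"
    by (real_asymp simp: field_simps)
  ultimately show "(\<lambda>n. real n * (square_term y n / square_term y (Suc n) - 1)) \<longlonglongrightarrow> 2 + y"
    by simp
qed (use assms in simp)

lemma summable_odd_squares: "summable (\<lambda>n. 1 / (2 * real n + 1)\<^sup>2)"
proof -
  have "quot_prod n 0 = 1" for n by (simp add: quot_prod_def)
  then have "square_term 0 = (\<lambda>n. 1 / (2 * real n + 1)\<^sup>2)"
    by (simp add: fun_eq_iff square_term_def power2_eq_square)
  then show ?thesis
    using summable_square_term_neg[of 0] by simp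
qed

lemma abs_square_term_le:
  assumes "y \<ge> 0"
  shows "\<bar>square_term y n\<bar> \<le> 1 / (2 * real n + 1)\<^sup>2"
proof -
  have "\<bar>square_term y n\<bar> = \<bar>quot_prod n y\<bar> / ((2 * real n + 1) * (2 * real n + 1 + y))"
    using assms by (simp add: square_term_def abs_divide abs_mult)
  also have "\<dots> \<le> 1 / ((2 * real n + 1) * (2 * real n + 1))"
    using assms by (intro frac_le abs_quot_prod_le mult_mono) auto
  finally show ?thesis by (simp add: power2_eq_square)
qed

lemma summable_square_term: "y \<ge> 0 \<Longrightarrow> summable (square_term y)"
  by (rule summable_comparison_test'[OF summable_odd_squares, of 0]) (use abs_square_term_le in auto)

text \<open>The Wallis-type quantity \<open>(cbin n)^2 * (2 * n + 1)\<close> starts at 1 and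
  decreases, since \<open>(2 * n + 1) * (2 * n + 3)\<close> is less than
  \<open>(2 * n + 2)^2\<close>.\<close>

lemma cbin_tendsto_0: "cbin \<longlonglongrightarrow> 0"
proof (rule Lim_null_comparison[OF always_eventually])
  have "(cbin n)\<^sup>2 * (2 * real n + 1) \<le> 1" for n
  proof (induction n)
    case (Suc n)
    have "(cbin (Suc n))\<^sup>2 * (2 * real (Suc n) + 1)
        = (cbin n)\<^sup>2 * (2 * real n + 1) * ((2 * real n + 1) * (2 * real n + 3) / (2 * real n + 2)\<^sup>2)"
      by (simp add: cbin_Suc power_mult_distrib power_divide) (simp add: power2_eq_square algebra_simps)
    also have "\<dots> \<le> 1 * 1"
    proof (intro mult_mono Suc)
      show "(2 * real n + 1) * (2 * real n + 3) / (2 * real n + 2)\<^sup>2 \<le> 1"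
        by (subst divide_le_eq_1_pos[OF zero_less_power]) (auto simp: power2_eq_square algebra_simps)
    qed auto
    finally show ?case by simp
  qed (simp add: cbin_def)
  then have "(cbin n)\<^sup>2 \<le> 1 / (2 * real n + 1)" for n
    by (simp add: pos_le_divide_eq)
  then have "cbin n \<le> sqrt (1 / (2 * real n + 1))" for n
    by (rule real_le_rsqrt)
  then show "\<forall>n. norm (cbin n) \<le> sqrt (1 / (2 * real n + 1))"
    using cbin_pos by (simp add: less_imp_le)
  show "(\<lambda>n. sqrt (1 / (2 * real n + 1))) \<longlonglongrightarrow> 0"
    by real_asymp
qed

text \<open>Summing the telescoping identity leaves no boundary terms: the factor \<open>n\<close>
  kills the one at 0, and \<open>n * binom_term y n\<close> is dominated by
  \<open>cbin n\<close>.\<close>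

lemma suminf_binom_term_rec:
  assumes "y \<ge> 0"
  shows "(2 + y)\<^sup>2 * suminf (binom_term (y + 2)) = (1 + y)\<^sup>2 * suminf (binom_term y)"
proof -
  have y: "y > -1" using assms by simp
  have bound: "norm (real n * binom_term y n) \<le> cbin n" for n
  proof -
    have "real n * binom_term y n \<le> real n * (cbin n / (2 * real n + 1) * 1)"
      unfolding binom_term_def using assms cbin_pos[of n]
      by (intro mult_left_mono star_prod_le) auto
    also have "\<dots> \<le> cbin n"
      using cbin_pos[of n] by (simp add: divide_simps)
    finally show ?thesis
      using binom_term_pos[OF y, of n] by simp
  qed
  have lim: "(\<lambda>n. real n * binom_term y n) \<longlonglongrightarrow> 0"
  proof (rule Lim_null_comparison)
    show "\<forall>\<^sub>F n in sequentially. norm (real n * binom_term y n) \<le> cbin n"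
      using bound by simp
    show "cbin \<longlonglongrightarrow> 0"
      by (rule cbin_tendsto_0)
  qed
  have "(\<lambda>n. 2 * (1 + y) * (real (Suc n) * binom_term y (Suc n) - real n * binom_term y n)) sums (2 * (1 + y) * (0 - real 0 * binom_term y 0))"
    by (intro sums_mult telescope_sums lim)
  then have "(\<lambda>n. (2 + y)\<^sup>2 * binom_term (y + 2) n - (1 + y)\<^sup>2 * binom_term y n) sums 0"
    unfolding binom_term_telescope[OF y] by simp
  moreover have "(\<lambda>n. (2 + y)\<^sup>2 * binom_term (y + 2) n - (1 + y)\<^sup>2 * binom_term y n) sums
     ((2 + y)\<^sup>2 * suminf (binom_term (y + 2)) - (1 + y)\<^sup>2 * suminf (binom_term y))"
    using assms by (intro sums_diff sums_mult summable_sums summable_binom_term) auto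
  ultimately show ?thesis
    using sums_unique2 by fastforce
qed

text \<open>The certificate vanishes at 0, and it is of order \<open>1 / n\<close> because
  \<open>quot_prod n y\<close> is bounded by 1 in absolute value.\<close>

lemma suminf_square_term_rec:
  assumes "y \<ge> 0" "\<And>j. y \<noteq> 2 * real j + 1"
  shows "(2 + y)\<^sup>2 * suminf (square_term (y + 2)) = (1 + y)\<^sup>2 * suminf (square_term y)"
proof -
  have y: "y > -1" using assms by simp
  define w where "w = (\<lambda>n. real n * quot_prod n y / ((2 * real n - 1 - y) * (2 * real n + 1 + y)))"
  have lim: "w \<longlonglongrightarrow> 0"
  proof (rule Lim_null_comparison)
    have "norm (w n) \<le> \<bar>real n / ((2 * real n - 1 - y) * (2 * real n + 1 + y))\<bar>" for n
    proof -
      have "norm (w n) = \<bar>quot_prod n y\<bar> * \<bar>real n / ((2 * real n - 1 - y) * (2 * real n + 1 + y))\<bar>"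
        by (simp add: w_def abs_mult abs_divide)
      also have "\<dots> \<le> 1 * \<bar>real n / ((2 * real n - 1 - y) * (2 * real n + 1 + y))\<bar>"
        by (intro mult_right_mono abs_quot_prod_le assms) auto
      finally show ?thesis by simp
    qed
    then show "\<forall>\<^sub>F n in sequentially. norm (w n) \<le> \<bar>real n / ((2 * real n - 1 - y) * (2 * real n + 1 + y))\<bar>"
      by simp
    show "(\<lambda>n. \<bar>real n / ((2 * real n - 1 - y) * (2 * real n + 1 + y))\<bar>) \<longlonglongrightarrow> 0"
      by real_asymp
  qed
  have "(\<lambda>n. (1 + y) * (w (Suc n) - w n)) sums ((1 + y) * (0 - w 0))"
    by (intro sums_mult telescope_sums lim)
  then have "(\<lambda>n. (2 + y)\<^sup>2 * square_term (y + 2) n - (1 + y)\<^sup>2 * square_term y n) sums 0"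
    unfolding square_term_telescope[OF y assms(2)] w_def by simp
  moreover have "(\<lambda>n. (2 + y)\<^sup>2 * square_term (y + 2) n - (1 + y)\<^sup>2 * square_term y n) sums
     ((2 + y)\<^sup>2 * suminf (square_term (y + 2)) - (1 + y)\<^sup>2 * suminf (square_term y))"
    using assms by (intro sums_diff sums_mult summable_sums summable_square_term) auto
  ultimately show ?thesis
    using sums_unique2 by fastforce
qed

section \<open>Asymptotics for large \<open>y\<close>\<close>

text \<open>The term at \<open>n = 0\<close> is \<open>1 / (1 + y)\<close> and gives the limit. In
  all others \<open>star_prod\<close> is at most its value \<open>3 / ((1 + y) * (3 + y))\<close> at
  length 2, so together they are of order \<open>1 / y^2\<close>, with the tail \<open>S\<close> of
  the series at \<open>y = 0\<close> as a constant.\<close>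

lemma suminf_binom_term_asymp: "((\<lambda>y. y * suminf (binom_term y)) \<longlongrightarrow> 1) at_top"
proof -
  define S where "S = (\<Sum>n. cbin (Suc n) / (2 * real n + 3))"
  have "binom_term 0 n = cbin n / (2 * real n + 1)" for n
  proof -
    have "star_prod m 0 = 1" for m by (simp add: star_prod_def)
    then show ?thesis by (simp add: binom_term_def)
  qed
  then have "summable (\<lambda>n. cbin (Suc n) / (2 * real (Suc n) + 1))"
    using summable_Suc_iff[of "binom_term 0"] summable_binom_term[of 0] by simp
  then have sumS: "summable (\<lambda>n. cbin (Suc n) / (2 * real n + 3))"
    by (simp add: add_ac)
  have bound: "\<bar>y * suminf (binom_term y) - y / (1 + y)\<bar> \<le> 3 * S / (3 + y)" if y: "y > 0" for y
  proof -
    have y1: "y > -1" using y by simp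
    have le: "binom_term y (Suc n) \<le> 3 / ((1 + y) * (3 + y)) * (cbin (Suc n) / (2 * real n + 3))" for n
    proof -
      have "star_prod (Suc (Suc n)) y \<le> 3 / ((1 + y) * (3 + y))"
      proof (induction n)
        case 0
        then show ?case using y by (simp add: star_prod_Suc)
      next
        case (Suc n)
        have "star_prod (Suc (Suc (Suc n))) y \<le> star_prod (Suc (Suc n)) y * 1"
          unfolding star_prod_Suc[of "Suc (Suc n)"] using y star_prod_pos[OF y1, of "Suc (Suc n)"]
          by (intro mult_left_mono) (auto simp: divide_simps)
        with Suc show ?case by simp
      qed
      then have "cbin (Suc n) / (2 * real (Suc n) + 1) * star_prod (Suc (Suc n)) y
          \<le> cbin (Suc n) / (2 * real (Suc n) + 1) * (3 / ((1 + y) * (3 + y)))"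
        using cbin_pos[of "Suc n"] by (intro mult_left_mono) auto
      then show ?thesis by (simp add: binom_term_def add_ac mult_ac)
    qed
    have "(\<Sum>n. binom_term y (Suc n)) \<le> (\<Sum>n. 3 / ((1 + y) * (3 + y)) * (cbin (Suc n) / (2 * real n + 3)))"
      using le by (intro suminf_le summable_mult sumS summable_binom_term[OF y1, THEN summable_Suc_iff[THEN iffD2]])
    also have "\<dots> = 3 / ((1 + y) * (3 + y)) * S"
      unfolding S_def by (rule suminf_mult[OF sumS])
    finally have "(\<Sum>n. binom_term y (Suc n)) \<le> 3 / ((1 + y) * (3 + y)) * S" .
    then have "y * (\<Sum>n. binom_term y (Suc n)) \<le> y * (3 / ((1 + y) * (3 + y)) * S)"
      using y by (intro mult_left_mono) auto
    also have "\<dots> = y / (1 + y) * (3 * S / (3 + y))"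
      by simp
    also have "\<dots> \<le> 1 * (3 * S / (3 + y))"
    proof (intro mult_right_mono)
      have "S \<ge> 0" unfolding S_def by (intro suminf_nonneg sumS) (auto intro!: divide_nonneg_pos less_imp_le[OF cbin_pos])
      then show "0 \<le> 3 * S / (3 + y)" using y by simp
    qed (use y in auto)
    finally have "y * (\<Sum>n. binom_term y (Suc n)) \<le> 3 * S / (3 + y)" by simp
    moreover have "0 \<le> y * (\<Sum>n. binom_term y (Suc n))"
      using y binom_term_pos[OF y1]
      by (intro mult_nonneg_nonneg suminf_nonneg summable_binom_term[OF y1, THEN summable_Suc_iff[THEN iffD2]]) (auto simp: less_imp_le)
    moreover have "binom_term y 0 = 1 / (1 + y)"
      by (simp add: binom_term_def star_prod_Suc cbin_def)
    then have "y * suminf (binom_term y) - y / (1 + y) = y * (\<Sum>n. binom_term y (Suc n))"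
      unfolding suminf_split_head[OF summable_binom_term[OF y1]] by (simp add: algebra_simps)
    ultimately show ?thesis by simp
  qed
  have "((\<lambda>y. y * suminf (binom_term y) - y / (1 + y)) \<longlongrightarrow> 0) at_top"
  proof (rule Lim_null_comparison)
    show "\<forall>\<^sub>F y in at_top. norm (y * suminf (binom_term y) - y / (1 + y)) \<le> 3 * S / (3 + y)"
      using eventually_gt_at_top[of 0] by eventually_elim (use bound in simp)
    show "((\<lambda>y. 3 * S / (3 + y)) \<longlongrightarrow> 0) at_top"
      by real_asymp
  qed
  moreover have "((\<lambda>y::real. y / (1 + y)) \<longlongrightarrow> 1) at_top"
    by real_asymp
  ultimately show ?thesis
    using tendsto_add by fastforce
qed

text \<open>Since \<open>2 * y * square_term y n\<close> is \<open>h n\<close> times a difference of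
  consecutive \<open>quot_prod\<close>, summation by parts moves the difference to \<open>h\<close>.
  The new terms \<open>T y n\<close> are dominated uniformly in \<open>y\<close> by a telescoping
  series, and \<open>quot_prod n y\<close> tends to \<open>(-1) ^ n\<close>, so Tannery's theorem
  applies.\<close>

lemma suminf_square_term_asymp: "((\<lambda>y. y * suminf (square_term y)) \<longlongrightarrow> pi / 4) at_top"
proof -
  define h where "h = (\<lambda>n. 1 / (2 * real n + 1))"
  have h0: "h \<longlonglongrightarrow> 0" unfolding h_def by real_asymp
  have hdec: "h n - h (Suc n) \<ge> 0" for n
    by (simp add: h_def frac_le)
  define T where "T = (\<lambda>y n. quot_prod (Suc n) y * (h n - h (Suc n)))"
  have eq: "2 * (y * suminf (square_term y)) = 1 - suminf (T y)" if y: "y \<ge> 0" for y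
  proof -
    have "(\<lambda>n. quot_prod n y * h n) \<longlonglongrightarrow> 0"
    proof (rule Lim_null_comparison[OF _ h0], intro always_eventually allI)
      fix n
      have "\<bar>quot_prod n y\<bar> * h n \<le> 1 * h n"
        by (intro mult_right_mono abs_quot_prod_le y) (simp add: h_def)
      then show "norm (quot_prod n y * h n) \<le> h n"
        by (simp add: abs_mult h_def)
    qed
    from telescope_sums'[OF this]
    have 1: "(\<lambda>n. quot_prod n y * h n - quot_prod (Suc n) y * h (Suc n)) sums 1"
      by (simp add: h_def)
    have 2: "(\<lambda>n. 2 * y * square_term y n) sums (2 * y * suminf (square_term y))"
      by (intro sums_mult summable_sums summable_square_term y)
    have "quot_prod n y * h n - quot_prod (Suc n) y * h (Suc n) - 2 * y * square_term y n = T y n" for n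
    proof -
      have "2 * real n + 1 + y \<noteq> 0" using y by linarith
      then have "2 * y * square_term y n = (quot_prod n y - quot_prod (Suc n) y) * h n"
        by (simp add: square_term_def quot_prod_Suc h_def divide_simps) (simp add: algebra_simps)
      then show ?thesis by (simp add: T_def algebra_simps)
    qed
    then have "T y sums (1 - 2 * y * suminf (square_term y))"
      using sums_diff[OF 1 2] by simp
    then show ?thesis by (simp add: sums_iff)
  qed
  have "((\<lambda>y. suminf (T y)) \<longlongrightarrow> (\<Sum>n. (-1) ^ Suc n * (h n - h (Suc n)))) at_top"
  proof (rule tannerys_theorem[THEN conjunct2, THEN conjunct2])
    have "((\<lambda>y. quot_prod n y) \<longlongrightarrow> (\<Prod>j<n. -1)) at_top" for n
      unfolding quot_prod_def by (intro tendsto_prod) real_asymp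
    then show "((\<lambda>y. T y n) \<longlongrightarrow> (-1) ^ Suc n * (h n - h (Suc n))) at_top" for n
      unfolding T_def by (intro tendsto_mult tendsto_const) (simp del: power_Suc)
    show "summable (\<lambda>n. h n - h (Suc n))"
      by (rule telescope_summable'[OF h0])
    have "norm (T y n) \<le> h n - h (Suc n)" if "y \<ge> 0" for y n
      using mult_right_mono[OF abs_quot_prod_le[OF that] hdec, of "Suc n" n] hdec[of n]
      by (simp add: T_def abs_mult)
    then show "\<forall>\<^sub>F (n, y) in sequentially \<times>\<^sub>F at_top. norm (T y n) \<le> h n - h (Suc n)"
      unfolding case_prod_unfold
      by (intro eventually_mono[OF eventually_prodI[OF always_eventually[of "\<lambda>_. True"] eventually_ge_at_top[of 0]]]) auto
  qed simp
  also have "(\<Sum>n. (-1) ^ Suc n * (h n - h (Suc n))) = 1 - pi / 2"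
  proof -
    \<comment> \<open>The limit splits into two copies of Leibniz's series, one of them shifted,
      with values \<open>- pi / 4\<close> and \<open>pi / 4 - 1\<close>.\<close>
    have s: "(\<lambda>n. (-1) ^ n * h n) sums (pi / 4)"
      using summable_arctan_series[of 1] pi_series
      by (simp add: h_def sums_iff mult.commute add.commute)
    have "(\<lambda>n. (-1) ^ Suc n * h (Suc n)) sums (pi / 4 - 1)"
      using sums_Suc_iff[of "\<lambda>n. (-1) ^ n * h n" "pi / 4 - 1"] s by (simp add: h_def)
    from sums_diff[OF sums_minus[OF s] this]
    show ?thesis by (simp add: sums_iff algebra_simps)
  qed
  finally have "((\<lambda>y. (1 - suminf (T y)) / 2) \<longlongrightarrow> (1 - (1 - pi / 2)) / 2) at_top"
    by (intro tendsto_intros) auto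
  moreover have "(1 - suminf (T y)) / 2 = y * suminf (square_term y)" if "y \<ge> 0" for y
    using eq[OF that] by simp
  then have "\<forall>\<^sub>F y in at_top. (1 - suminf (T y)) / 2 = y * suminf (square_term y)"
    using eventually_ge_at_top[of 0] by (rule eventually_mono[rotated])
  ultimately show ?thesis
    using tendsto_cong by fastforce
qed

text \<open>
  With \<open>E\<close> the difference of the two sides, \<open>y * \<bar>E y\<bar>\<close> increases along \<open>y, y + 2, y + 4, \<dots>\<close>
  because \<open>y * (2 + y)\<^sup>2 \<le> (y + 2) * (1 + y)\<^sup>2\<close>, and it tends to 0.
\<close>

lemma suminf_binom_term_eq:
  assumes "0 < y" "y < 1"
  shows "suminf (binom_term y) = 4 / pi * suminf (square_term y)"
proof -
  define E where "E = (\<lambda>y. suminf (binom_term y) - 4 / pi * suminf (square_term y))"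
  have "((\<lambda>y. y * suminf (binom_term y) - 4 / pi * (y * suminf (square_term y))) \<longlongrightarrow> 1 - 4 / pi * (pi / 4)) at_top"
    by (intro tendsto_intros suminf_binom_term_asymp suminf_square_term_asymp)
  then have lim: "((\<lambda>y. \<bar>y * E y\<bar>) \<longlongrightarrow> 0) at_top"
    by (intro tendsto_rabs_zero) (simp add: E_def algebra_simps)
  define s where "s = (\<lambda>k. \<bar>(y + 2 * real k) * E (y + 2 * real k)\<bar>)"
  have "filterlim (\<lambda>k. y + 2 * real k) at_top sequentially"
    by real_asymp
  then have "s \<longlonglongrightarrow> 0"
    unfolding s_def by (rule filterlim_compose[OF lim])
  moreover have "incseq s"
  proof (rule incseq_SucI)
    fix k
    define z where "z = y + 2 * real k"
    have z: "z > 0" using assms by (simp add: z_def)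
    \<comment> \<open>Even shifts of a point strictly between 0 and 1 never reach an odd integer,
      where \<open>suminf_square_term_rec\<close> does not apply.\<close>
    have odd: "z \<noteq> 2 * real j + 1" for j
    proof
      assume "z = 2 * real j + 1"
      then have "y = of_int (2 * int j + 1 - 2 * int k)" by (simp add: z_def)
      with assms have "0 < 2 * int j + 1 - 2 * int k" "2 * int j + 1 - 2 * int k < 1"
        by linarith+
      then show False by presburger
    qed
    have rec: "(2 + z)\<^sup>2 * E (z + 2) = (1 + z)\<^sup>2 * E z"
      using suminf_binom_term_rec[of z] suminf_square_term_rec[of z] z odd
      by (simp add: E_def right_diff_distrib mult.left_commute[of _ "4 / pi"])
    have "(2 + z)\<^sup>2 * (z * \<bar>E z\<bar>) = (z * (2 + z)\<^sup>2) * \<bar>E z\<bar>" by simp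
    \<comment> \<open>The two factors in front of \<open>\<bar>E z\<bar>\<close> differ by exactly
      \<open>z + 2\<close>.\<close>
    also have "\<dots> \<le> ((z + 2) * (1 + z)\<^sup>2) * \<bar>E z\<bar>"
      using z by (intro mult_right_mono) (auto simp: power2_eq_square algebra_simps)
    also have "\<dots> = (z + 2) * \<bar>(1 + z)\<^sup>2 * E z\<bar>" by (simp add: abs_mult)
    also have "\<dots> = (2 + z)\<^sup>2 * ((z + 2) * \<bar>E (z + 2)\<bar>)"
      unfolding rec[symmetric] by (simp add: abs_mult)
    finally have "z * \<bar>E z\<bar> \<le> (z + 2) * \<bar>E (z + 2)\<bar>"
      using z by (simp add: mult_le_cancel_left)
    moreover have "y + 2 * real (Suc k) = z + 2" by (simp add: z_def)
    ultimately show "s k \<le> s (Suc k)"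
      using z unfolding s_def \<open>y + 2 * real (Suc k) = z + 2\<close> z_def[symmetric] by (simp add: abs_mult)
  qed
  ultimately have "s 0 \<le> 0" by (rule incseq_le[rotated])
  then have "E y = 0" using assms by (simp add: s_def)
  then show ?thesis by (simp add: E_def)
qed

section \<open>Comparison of coefficients\<close>

text \<open>Zeros of a nonzero power series are isolated, so vanishing on one side of 0 is
  enough.\<close>

lemma powser_coeff_eq_0:
  fixes c :: "nat \<Rightarrow> real"
  assumes r: "r > 0" and f: "\<And>x. \<bar>x\<bar> < r \<Longrightarrow> (\<lambda>m. c m * x ^ m) sums f x"
    and zero: "\<And>x. -r < x \<Longrightarrow> x < 0 \<Longrightarrow> f x = 0"
  shows "c m = 0"
proof (rule ccontr)
  assume c: "c m \<noteq> 0"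
  \<comment> \<open>The series is multiplied by \<open>x\<close> because
    \<open>powser_0_nonzero\<close> asks for a function that vanishes at the centre and a nonzero
    coefficient of positive index.\<close>
  define c' where "c' = (\<lambda>m. case m of 0 \<Rightarrow> 0 | Suc m \<Rightarrow> c m)"
  have "(\<lambda>m. c' m * (x - 0) ^ m) sums (x * f x)" if "norm (x - 0) < r" for x
  proof -
    have "(\<lambda>m. x * (c m * x ^ m)) sums (x * f x)"
      using that by (intro sums_mult f) simp
    then have "(\<lambda>m. c' (Suc m) * x ^ Suc m) sums (x * f x)"
      by (simp add: c'_def mult_ac)
    then show ?thesis
      using sums_Suc_iff[of "\<lambda>m. c' m * x ^ m" "x * f x"] by (simp add: c'_def)
  qed
  then obtain s where s: "s > 0" "\<And>z. z \<in> cball 0 s - {0} \<Longrightarrow> z * f z \<noteq> 0"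
    using powser_0_nonzero[OF r, where a = c' and \<xi> = 0 and f = "\<lambda>x. x * f x" and m = "Suc m"] c by (auto simp: c'_def)
  define z where "z = - min s r / 2"
  have "z * f z \<noteq> 0" using s(1) r by (intro s(2)) (auto simp: z_def)
  moreover have "f z = 0" using s(1) r by (intro zero) (auto simp: z_def)
  ultimately show False by simp
qed

text \<open>As the coefficients are nonnegative, convergence of the double sum at the single point
  \<open>r\<close> dominates the partial sums for all \<open>x\<close> with absolute value at most
  \<open>r\<close>, and Tannery's theorem justifies the exchange.\<close>

lemma powser_interchange:
  fixes c :: "nat \<Rightarrow> nat \<Rightarrow> real"
  assumes nonneg: "\<And>n m. c n m \<ge> 0" and r: "r > 0"
    and inner: "\<And>n. summable (\<lambda>m. c n m * r ^ m)"
    and outer: "summable (\<lambda>n. \<Sum>m. c n m * r ^ m)"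
  shows "summable (\<lambda>n. c n m)"
    and "\<bar>x\<bar> \<le> r \<Longrightarrow> (\<lambda>m. (\<Sum>n. c n m) * x ^ m) sums (\<Sum>n. \<Sum>m. c n m * x ^ m)"
proof -
  have le: "c n m * r ^ m \<le> (\<Sum>m. c n m * r ^ m)" for n m
    using sum_le_suminf[OF inner, of "{m}" n] nonneg r by simp
  have "summable (\<lambda>n. c n m * r ^ m)" for m
    by (rule summable_comparison_test'[OF outer, of 0]) (use le nonneg r in auto)
  then have summ: "summable (\<lambda>n. c n m)" for m
    using summable_mult2[of "\<lambda>n. c n m * r ^ m" "1 / r ^ m"] r by simp
  then show "summable (\<lambda>n. c n m)" .
  assume x: "\<bar>x\<bar> \<le> r"
  have norm_le: "norm (c n m * x ^ m) \<le> c n m * r ^ m" for n m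
    using nonneg x by (simp add: abs_mult power_abs mult_left_mono power_mono)
  have "(\<lambda>M. \<Sum>n. \<Sum>m<M. c n m * x ^ m) \<longlonglongrightarrow> (\<Sum>n. \<Sum>m. c n m * x ^ m)"
  proof (rule tannerys_theorem[THEN conjunct2, THEN conjunct2])
    show "(\<lambda>M. \<Sum>m<M. c n m * x ^ m) \<longlonglongrightarrow> (\<Sum>m. c n m * x ^ m)" for n
      by (intro summable_LIMSEQ summable_comparison_test'[OF inner[of n], of 0] norm_le)
    have "norm (\<Sum>m<M. c n m * x ^ m) \<le> (\<Sum>m. c n m * r ^ m)" for n M
    proof -
      have "norm (\<Sum>m<M. c n m * x ^ m) \<le> (\<Sum>m<M. c n m * r ^ m)"
        by (intro sum_norm_le norm_le)
      also have "\<dots> \<le> (\<Sum>m. c n m * r ^ m)"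
        using nonneg r by (intro sum_le_suminf inner) auto
      finally show ?thesis .
    qed
    then show "\<forall>\<^sub>F (n, M) in sequentially \<times>\<^sub>F sequentially. norm (\<Sum>m<M. c n m * x ^ m) \<le> (\<Sum>m. c n m * r ^ m)"
      by (intro always_eventually) auto
  qed (use outer in auto)
  moreover have "(\<Sum>n. \<Sum>m<M. c n m * x ^ m) = (\<Sum>m<M. (\<Sum>n. c n m) * x ^ m)" for M
    by (subst suminf_sum) (auto intro: summable_mult2 summ simp: suminf_mult2[OF summ])
  ultimately show "(\<lambda>m. (\<Sum>n. c n m) * x ^ m) sums (\<Sum>n. \<Sum>m. c n m * x ^ m)"
    by (simp add: sums_def)
qed

section \<open>Evaluating the formal power series\<close>

lemma eval_geom_fps:
  assumes "0 \<le> c" "c \<le> 1"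
  shows "fps_conv_radius (geom_fps c) \<ge> 1"
    and "\<bar>x\<bar> < 1 \<Longrightarrow> eval_fps (geom_fps c) x = 1 / (1 - c * x)"
proof -
  have *: "(\<lambda>n. c ^ n * x ^ n) sums (1 / (1 - c * x))" if "\<bar>x\<bar> < 1" for x
  proof -
    have "\<bar>c * x\<bar> \<le> 1 * \<bar>x\<bar>"
      unfolding abs_mult using assms by (intro mult_right_mono) auto
    then have "norm (c * x) < 1" using that by simp
    from geometric_sums[OF this] show ?thesis by (simp add: power_mult_distrib)
  qed
  show "fps_conv_radius (geom_fps c) \<ge> 1"
    unfolding fps_conv_radius_def
    by (rule conv_radius_geI_ex') (use * in \<open>auto simp: geom_fps_def sums_iff\<close>)
  show "\<bar>x\<bar> < 1 \<Longrightarrow> eval_fps (geom_fps c) x = 1 / (1 - c * x)"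
    using * by (simp add: eval_fps_def geom_fps_def sums_iff)
qed

lemma fps_conv_radius_multI:
  assumes "fps_conv_radius f \<ge> R" "fps_conv_radius g \<ge> R"
  shows "fps_conv_radius (f * g) \<ge> R"
  using assms fps_conv_radius_mult[of f g] by (meson min.boundedI order_trans)

lemma fps_conv_radius_linear: "fps_conv_radius (1 + fps_const c * fps_X :: real fps) = \<infinity>"
proof -
  have "fps_conv_radius (fps_const c * fps_X :: real fps) = \<infinity>"
    using fps_conv_radius_multI[of \<infinity> "fps_const c" fps_X] by simp
  then show ?thesis
    using fps_conv_radius_add[of 1 "fps_const c * fps_X"] by simp
qed

text \<open>Evaluation is multiplicative only where both factors converge. The uniform radius bound
  1 is therefore established first and used in the induction.\<close>

lemma eval_t_star_fps:
  shows "fps_conv_radius (t_star_fps n) \<ge> 1"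
    and "\<bar>x\<bar> < 1 \<Longrightarrow> eval_fps (t_star_fps n) x = star_prod n (- x)"
proof -
  show conv: "fps_conv_radius (t_star_fps n) \<ge> 1" for n
    by (induction n) (simp_all add: t_star_fps_0 t_star_fps_Suc fps_conv_radius_multI eval_geom_fps)
  assume x: "\<bar>x\<bar> < 1"
  show "eval_fps (t_star_fps n) x = star_prod n (- x)"
  proof (induction n)
    case (Suc n)
    let ?g = "geom_fps (1 / (2 * real n + 1))"
    have x': "ereal (norm x) < 1" using x by simp
    have "fps_conv_radius ?g \<ge> 1" by (rule eval_geom_fps(1)) auto
    with less_le_trans[OF x' conv[of n]] less_le_trans[OF x', of "fps_conv_radius ?g"]
    have "eval_fps (t_star_fps (Suc n)) x = star_prod n (- x) * (1 / (1 - 1 / (2 * real n + 1) * x))"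
      unfolding t_star_fps_Suc using Suc x eval_geom_fps(2)[of "1 / (2 * real n + 1)" x]
      by (simp add: eval_fps_mult)
    also have "1 / (1 - 1 / (2 * real n + 1) * x) = (2 * real n + 1) / (2 * real n + 1 + - x)"
      by (simp add: divide_simps)
    finally show ?case by (simp only: star_prod_Suc)
  qed (simp add: t_star_fps_0)
qed

lemma eval_t_fps:
  shows "fps_conv_radius (t_fps n) = \<infinity>"
    and "eval_fps (t_fps n) x = (\<Prod>j<n. (2 * real j + 1 + x) / (2 * real j + 1))"
proof -
  show conv: "fps_conv_radius (t_fps n) = \<infinity>" for n
  proof (induction n)
    case (Suc n)
    then show ?case
      using fps_conv_radius_multI[of \<infinity> "t_fps n"] by (simp add: t_fps_Suc fps_conv_radius_linear)
  qed (simp add: t_fps_0)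
  show "eval_fps (t_fps n) x = (\<Prod>j<n. (2 * real j + 1 + x) / (2 * real j + 1))"
  proof (induction n)
    case (Suc n)
    have "fps_conv_radius (fps_const c * fps_X :: real fps) = \<infinity>" for c
      using fps_conv_radius_multI[of \<infinity> "fps_const c" fps_X] by simp
    then have "eval_fps (t_fps (Suc n)) x = eval_fps (t_fps n) x * (1 + 1 / (2 * real n + 1) * x)"
      unfolding t_fps_Suc using conv[of n]
      by (simp add: eval_fps_mult eval_fps_add fps_conv_radius_linear)
    also have "1 + 1 / (2 * real n + 1) * x = (2 * real n + 1 + x) / (2 * real n + 1)"
      by (simp add: divide_simps)
    finally show ?case by (simp add: Suc)
  qed (simp add: t_fps_0)
qed

definition binom_coeff :: "nat \<Rightarrow> nat \<Rightarrow> real" where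
  "binom_coeff n m = 1 / 4 ^ n * real ((2 * n) choose n) * t_star_sum (n + 1) (ones m) / (2 * real n + 1)"

definition square_coeff :: "nat \<Rightarrow> nat \<Rightarrow> real" where
  "square_coeff n m = (\<Sum>k=0..m. t_sum n (ones k) * t_star_sum (n + 1) (ones (m - k)) / (2 * real n + 1)\<^sup>2)"

lemma binom_coeff_sums:
  assumes "\<bar>x\<bar> < 1"
  shows "(\<lambda>m. binom_coeff n m * x ^ m) sums binom_term (- x) n"
proof -
  have "ereal (norm x) < 1" using assms by simp
  then have "ereal (norm x) < fps_conv_radius (t_star_fps (Suc n))"
    using eval_t_star_fps(1) by (rule less_le_trans)
  from sums_eval_fps[OF this]
  have "(\<lambda>m. cbin n / (2 * real n + 1) * (t_star_fps (Suc n) $ m * x ^ m))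
     sums (cbin n / (2 * real n + 1) * star_prod (Suc n) (- x))"
    by (intro sums_mult) (simp add: eval_t_star_fps(2) assms)
  moreover have "cbin n / (2 * real n + 1) * (t_star_fps (Suc n) $ m * x ^ m) = binom_coeff n m * x ^ m" for m
    by (simp add: cbin_def t_star_fps_def binom_coeff_def)
  ultimately show ?thesis
    by (simp only: binom_term_def)
qed

text \<open>The coefficient is a Cauchy product, so the value is the product of both evaluations.
  Their factors \<open>2 * j + 1\<close> cancel and leave \<open>quot_prod n (- x)\<close> and the
  last factor of the star product.\<close>

lemma square_coeff_sums:
  assumes "\<bar>x\<bar> < 1"
  shows "(\<lambda>m. square_coeff n m * x ^ m) sums square_term (- x) n"
proof -
  have x: "ereal (norm x) < 1" using assms by simp
  have conv: "fps_conv_radius (t_fps n) = \<infinity>" "fps_conv_radius (t_star_fps (Suc n)) \<ge> 1"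
    by (rule eval_t_fps(1), rule eval_t_star_fps(1))
  then have "fps_conv_radius (t_fps n * t_star_fps (Suc n)) \<ge> 1"
    by (intro fps_conv_radius_multI) auto
  then have "ereal (norm x) < fps_conv_radius (t_fps n * t_star_fps (Suc n))"
    using x by (rule less_le_trans[rotated])
  from sums_divide[OF sums_eval_fps[OF this], of "(2 * real n + 1)\<^sup>2"]
  have "(\<lambda>m. square_coeff n m * x ^ m) sums
      (eval_fps (t_fps n * t_star_fps (Suc n)) x / (2 * real n + 1)\<^sup>2)"
    by (simp add: square_coeff_def fps_mult_nth t_fps_def t_star_fps_def flip: sum_divide_distrib)
  also have "eval_fps (t_fps n * t_star_fps (Suc n)) x
     = (\<Prod>j<n. (2 * real j + 1 + x) / (2 * real j + 1)) * star_prod (Suc n) (- x)"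
    using conv x less_le_trans[OF x conv(2)]
    by (simp add: eval_fps_mult eval_t_fps(2) eval_t_star_fps(2) assms)
  also have "\<dots> = quot_prod n (- x) * ((2 * real n + 1) / (2 * real n + 1 - x))"
    unfolding star_prod_Suc mult.assoc[symmetric]
    by (simp add: star_prod_def quot_prod_def flip: prod.distrib)
  finally show ?thesis
    by (simp add: square_term_def power2_eq_square mult_ac)
qed

lemma binom_coeff_nonneg: "binom_coeff n m \<ge> 0"
  by (simp add: binom_coeff_def t_star_sum_nonneg)

lemma square_coeff_nonneg: "square_coeff n m \<ge> 0"
  unfolding square_coeff_def by (intro sum_nonneg) (simp add: t_star_sum_nonneg t_sum_nonneg)

lemma suminf_binom_coeff:
  shows "summable (\<lambda>n. binom_coeff n m)" and "summable (\<lambda>n. square_coeff n m)"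
    and "(\<Sum>n. binom_coeff n m) = 4 / pi * (\<Sum>n. square_coeff n m)"
proof -
  \<comment> \<open>The point \<open>x = 1/2\<close>, that is \<open>y = -1/2\<close>, serves as the
    dominating point \<open>r\<close> of \<open>powser_interchange\<close>.\<close>
  have b: "summable (\<lambda>m. binom_coeff n m * (1/2) ^ m)" "summable (\<lambda>n. \<Sum>m. binom_coeff n m * (1/2) ^ m)" for n
    using binom_coeff_sums[of "1/2"] summable_binom_term[of "-1/2"] by (simp_all add: sums_iff)
  have s: "summable (\<lambda>m. square_coeff n m * (1/2) ^ m)" "summable (\<lambda>n. \<Sum>m. square_coeff n m * (1/2) ^ m)" for n
    using square_coeff_sums[of "1/2"] summable_square_term_neg[of "-1/2"] by (simp_all add: sums_iff)
  note B = powser_interchange[OF binom_coeff_nonneg _ b, simplified]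
  note S = powser_interchange[OF square_coeff_nonneg _ s, simplified]
  show "summable (\<lambda>n. binom_coeff n m)" "summable (\<lambda>n. square_coeff n m)"
    by (rule B S)+
  have Bx: "(\<lambda>m. (\<Sum>n. binom_coeff n m) * x ^ m) sums suminf (binom_term (- x))" if "\<bar>x\<bar> < 1/2" for x
    using B(2)[of x] binom_coeff_sums[of x] that by (simp add: sums_iff)
  have Sx: "(\<lambda>m. (\<Sum>n. square_coeff n m) * x ^ m) sums suminf (square_term (- x))" if "\<bar>x\<bar> < 1/2" for x
    using S(2)[of x] square_coeff_sums[of x] that by (simp add: sums_iff)
  have "(\<Sum>n. binom_coeff n m) - 4 / pi * (\<Sum>n. square_coeff n m) = 0"
  proof (rule powser_coeff_eq_0)
    show "(\<lambda>m. ((\<Sum>n. binom_coeff n m) - 4 / pi * (\<Sum>n. square_coeff n m)) * x ^ m) sums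
       (suminf (binom_term (- x)) - 4 / pi * suminf (square_term (- x)))" if "\<bar>x\<bar> < 1/2" for x
      using sums_diff[OF Bx[OF that] sums_mult[OF Sx[OF that], of "4 / pi"]]
      by (simp add: left_diff_distrib mult.assoc)
    \<comment> \<open>The equality is known for \<open>y = - x\<close> between 0 and 1 only, hence
      for negative \<open>x\<close>.\<close>
    show "suminf (binom_term (- x)) - 4 / pi * suminf (square_term (- x)) = 0" if "- (1/2) < x" "x < 0" for x
      using suminf_binom_term_eq[of "- x"] that by simp
  qed simp
  then show "(\<Sum>n. binom_coeff n m) = 4 / pi * (\<Sum>n. square_coeff n m)" by simp
qed

theorem theorem7p3:
  fixes m :: nat
  shows
    "summable (\<lambda>n. 1 / 4 ^ n * real ((2 * n) choose n) * t_star_sum (n + 1) (ones m) / (2 * real n + 1))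
     \<and> (\<forall>k\<le>m. summable (\<lambda>n. t_sum n (ones k) * t_star_sum (n + 1) (ones (m - k)) / (2 * real n + 1)\<^sup>2))
     \<and> (\<Sum>n. 1 / 4 ^ n * real ((2 * n) choose n) * t_star_sum (n + 1) (ones m) / (2 * real n + 1))
         = 4 / pi * (\<Sum>k=0..m. \<Sum>n. t_sum n (ones k) * t_star_sum (n + 1) (ones (m - k)) / (2 * real n + 1)\<^sup>2)
     \<and> 4 / pi * (\<Sum>k=0..m. \<Sum>n. t_sum n (ones k) * t_star_sum (n + 1) (ones (m - k)) / (2 * real n + 1)\<^sup>2)
         = 4 / pi * (\<Sum>d=1..m+1. \<Sum>s\<in>{s \<in> compositions (m + 2). length s = d \<and> hd s \<ge> 2}. 2 ^ (d - 1) * mtv s)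
     \<and> (\<Sum>n. 1 / 4 ^ n * real ((2 * n) choose n) * t_star_sum (n + 1) (ones m) / (2 * real n + 1))
         \<in> (\<lambda>x. 1 / pi * x) ` MtV (m + 2)
     \<and> (\<lambda>x. 1 / pi * x) ` MtV (m + 2) \<subseteq> (\<lambda>x. 1 / pi * x) ` CMZV2 (m + 2)"
proof -
  define D where "D = (\<Sum>d=1..m+1. \<Sum>s\<in>{s \<in> compositions (m + 2). length s = d \<and> hd s \<ge> 2}. 2 ^ (d - 1) * mtv s)"
  let ?u = "\<lambda>k n. t_sum n (ones k) * t_star_sum (n + 1) (ones (m - k)) / (2 * real n + 1)\<^sup>2"
  have u_nonneg: "?u k n \<ge> 0" for k n
    by (simp add: t_sum_nonneg t_star_sum_nonneg)
  have square: "square_coeff n m = (\<Sum>k=0..m. ?u k n)" for n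
    by (simp add: square_coeff_def)
  have summ: "summable (?u k)" if "k \<le> m" for k
  \<comment> \<open>Each \<open>?u k n\<close> is one of the nonnegative summands of
    \<open>square_coeff n m\<close>, whose series converges.\<close>
  proof (rule summable_comparison_test'[OF suminf_binom_coeff(2)[of m], of 0])
    fix n
    have "?u k n \<le> square_coeff n m"
      unfolding square using that u_nonneg by (intro member_le_sum) auto
    then show "norm (?u k n) \<le> square_coeff n m"
      unfolding real_norm_def abs_of_nonneg[OF u_nonneg] .
  qed
  have "(\<Sum>n. square_coeff n m) = (\<Sum>k=0..m. suminf (?u k))"
    unfolding square by (rule suminf_sum) (use summ in auto)
  moreover have "(\<Sum>n. square_coeff n m) = D"
    using sum_sums_mtv[of m] unfolding square D_def by (simp add: sums_iff)
  ultimately have sum_D: "(\<Sum>k=0..m. suminf (?u k)) = D" by simp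
  have binom_D: "(\<Sum>n. binom_coeff n m) = 4 / pi * D"
    using suminf_binom_coeff(3)[of m] \<open>(\<Sum>n. square_coeff n m) = D\<close> by simp
  \<comment> \<open>The rational factor 4 is absorbed into the span, so that only
    \<open>1 / pi\<close> remains outside.\<close>
  have "4 * D \<in> MtV (m + 2)"
  proof -
    interpret vector_space "\<lambda>(q::rat) (x::real). of_rat q * x"
      by (rule vector_space_rat_real)
    let ?A = "{mtv s | s. s \<in> compositions (m + 2) \<and> (s = [] \<or> hd s \<ge> 2)}"
    have "of_rat (2 ^ (d - 1)) * mtv s \<in> span ?A" if "s \<in> compositions (m + 2)" "hd s \<ge> 2" for d s
      using that by (intro span_scale span_base) auto
    then have "D \<in> span ?A"
      unfolding D_def by (intro span_sum) (auto simp: of_rat_power)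
    then have "of_rat 4 * D \<in> span ?A" by (rule span_scale)
    then show ?thesis by (simp add: MtV_def rat_span_def)
  qed
  then have "4 / pi * D \<in> (\<lambda>x. 1 / pi * x) ` MtV (m + 2)"
    by (intro image_eqI[of _ _ "4 * D"]) auto
  moreover have "MtV (m + 2) \<subseteq> CMZV2 (m + 2)"
    by (rule MtV_subset_CMZV2) simp
  ultimately show ?thesis
    unfolding binom_coeff_def[symmetric] D_def[symmetric] sum_D binom_D
    using suminf_binom_coeff(1)[of m] summ by (intro conjI image_mono) auto
qed

end
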